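(* There exist universal constants $C,C'>0$ such that the following holds for all $n\ge1$ and $\epsilon,\delta\in(0,1)$. Let $$k\ \ge\ C\left(\frac{n^{2/3}\log^{1/3}(1/\delta)}{\epsilon^{4/3}}+\frac{n^{1/2}\log^{1/2}(1/\delta)+\log(1/\delta)}{\epsilon^2}\right).$$ Consider the following algorithm with sample access to distributions $p,q$ on $[n]$: draw $(\tilde m_p,\tilde m_p',\tilde m_q,\tilde m_q')\sim\mathrm{Multinom}(4k,(1/4,1/4,1/4,1/4))$; draw independent multisets of $\tilde m_p$ and $\tilde m_p'$ samples from $p$ and of $\tilde m_q$ and $\tilde m_q'$ samples from $q$, with histograms $\tilde X,\tilde X',\tilde Y,\tilde Y'\in\mathbb{Z}_{\ge0}^n$ respectively; compute $\tilde Z=\sum_{i=1}^n\big(|\tilde X_i-\tilde Y_i|+|\tilde X_i'-\tilde Y_i'|-|\tilde X_i-\tilde X_i'|-|\tilde Y_i-\tilde Y_i'|\big)$; output "YES" if $\tilde Z\le C'\sqrt{k\log(1/\delta)}$ and "NO" otherwise. Then this algorithm outputs "YES" with probability at least $1-\delta$ if $p=q$, and outputs "NO" with probability at least $1-\delta$ if $d_{\mathrm{TV}}(p,q)\ge\epsilon$.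
   Context: $d_{\mathrm{TV}}(p,q)=\frac12\sum_i|p_i-q_i|$. The histogram of a multiset of elements of $[n]$ is the vector whose $i$-th entry is the multiplicity of $i$. *)

theory Defs
  imports "HOL-Probability.Probability"
begin

text \<open>
  A distribution on \<open>[n]\<close> is a \<^typ>\<open>nat pmf\<close> whose support is contained in
  \<open>{1..n}\<close>.
\<close>

definition tv_dist :: "nat \<Rightarrow> nat pmf \<Rightarrow> nat pmf \<Rightarrow> real" where
  "tv_dist n p q = (1 / 2) * (\<Sum>i = 1..n. \<bar>pmf p i - pmf q i\<bar>)"

definition histogram :: "'a multiset \<Rightarrow> 'a \<Rightarrow> int" where
  "histogram M i = int (count M i)"

definition sample_multiset :: "nat \<Rightarrow> 'a pmf \<Rightarrow> 'a multiset pmf" where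
  "sample_multiset m p = map_pmf mset (replicate_pmf m p)"

text \<open>
  The multinomial distribution with \<open>N\<close> trials, as the joint law of the numbers of
  trials falling into each category when each trial independently selects a category
  according to \<open>w\<close>; the probability vector is given as a pmf on the categories.
\<close>

definition multinomial_pmf :: "nat \<Rightarrow> 'a pmf \<Rightarrow> ('a \<Rightarrow> nat) pmf" where
  "multinomial_pmf N w = map_pmf (\<lambda>cs c. count_list cs c) (replicate_pmf N w)"

definition test_statistic ::
  "nat \<Rightarrow> (nat \<Rightarrow> int) \<Rightarrow> (nat \<Rightarrow> int) \<Rightarrow> (nat \<Rightarrow> int) \<Rightarrow> (nat \<Rightarrow> int) \<Rightarrow> int" where
  "test_statistic n X X' Y Y' =
     (\<Sum>i = 1..n. \<bar>X i - Y i\<bar> + \<bar>X' i - Y' i\<bar> - \<bar>X i - X' i\<bar> - \<bar>Y i - Y' i\<bar>)"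

datatype answer = YES | NO

text \<open>
  The categories \<open>1, 2, 3, 4\<close> of the multinomial draw correspond, in this order, to the
  four sample sizes for \<open>X\<close>, \<open>X'\<close> (from \<open>p\<close>) and \<open>Y\<close>, \<open>Y'\<close> (from \<open>q\<close>).
  The argument \<open>c\<close> is the constant in the threshold.
\<close>

definition closeness_tester ::
  "real \<Rightarrow> nat \<Rightarrow> nat \<Rightarrow> real \<Rightarrow> nat pmf \<Rightarrow> nat pmf \<Rightarrow> answer pmf" where
  "closeness_tester c n k \<delta> p q = do {
     m \<leftarrow> multinomial_pmf (4 * k) (pmf_of_set {1..4::nat});
     S \<leftarrow> sample_multiset (m 1) p;
     S' \<leftarrow> sample_multiset (m 2) p;
     T \<leftarrow> sample_multiset (m 3) q;
     T' \<leftarrow> sample_multiset (m 4) q;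
     let Z = test_statistic n (histogram S) (histogram S') (histogram T) (histogram T');
     return_pmf (if real_of_int Z \<le> c * sqrt (real k * ln (1 / \<delta>)) then YES else NO)
   }"

end

theory Submission
  imports Defs
begin

text \<open>
  The tester is a function of \<open>4 * k\<close> independent labelled samples, and replacing one of them
  changes \<open>Z\<close> by at most \<open>4\<close>. McDiarmid's one-sided inequality therefore bounds both error
  probabilities by \<open>exp (- t\<^sup>2 / (32 * k))\<close>, without a factor \<open>2\<close>, so that \<open>\<delta>\<close> close to \<open>1\<close>
  needs no separate treatment. What remains is that the mean of \<open>Z\<close> vanishes for \<open>p = q\<close> and is
  at least twice the threshold for distant \<open>p\<close> and \<open>q\<close>.

  Let \<open>F\<^sub>m\<close> and \<open>G\<^sub>m\<close> be the distribution functions of the binomial distributions with \<open>m\<close> trials and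
  success probabilities \<open>p\<^sub>i\<close> and \<open>q\<^sub>i\<close>. Writing \<open>\<bar>a - b\<bar>\<close> as a sum of indicators over thresholds \<open>x\<close>,
  coordinate \<open>i\<close> contributes to the mean of \<open>Z\<close> twice the sum over \<open>x\<close> of the expectation of
  \<open>(F\<^sub>a x - G\<^sub>a x) * (F\<^sub>b x - G\<^sub>b x)\<close>, where \<open>a\<close> and \<open>b\<close> are two of the four multinomial
  sample sizes. All these terms are nonnegative by stochastic dominance. The joint probability of
  \<open>(a, b)\<close> is of order \<open>1 / k\<close> throughout the square \<open>{k - t..k} \<times> {k - t..k}\<close> with \<open>t\<close> of order
  \<open>sqrt k\<close>, so up to a constant \<open>a\<close> and \<open>b\<close> may be taken independent and uniform on
  \<open>{k - t..k}\<close>, which makes the sum over \<open>x\<close> a sum of squares. As the derivative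
  of \<open>F\<^sub>m x\<close> in the success probability is \<open>- m\<close> times a binomial probability, Chebyshev's
  inequality shows that a fixed fraction of the sum of \<open>F\<^sub>m - G\<^sub>m\<close> lies in a window of
  length of order \<open>1 + sqrt (k * max p\<^sub>i q\<^sub>i) + k * \<bar>p\<^sub>i - q\<^sub>i\<bar>\<close>. The Cauchy--Schwarz inequality, first
  over this window and then over the coordinates, gives the lower bound; its three
  denominators correspond to the three terms of the sample size.
\<close>

section \<open>McDiarmid's inequality for independent samples\<close>

lemma expectation_bind_pmf_finite:
  fixes h :: "'b \<Rightarrow> real"
  assumes "finite (set_pmf p)" "\<And>x. x \<in> set_pmf p \<Longrightarrow> finite (set_pmf (f x))"
  shows "measure_pmf.expectation (p \<bind> f) h
       = measure_pmf.expectation p (\<lambda>x. measure_pmf.expectation (f x) h)"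
  using assms
  by (subst pmf_expectation_bind[of "set_pmf p"]) (auto simp: integral_measure_pmf[of "set_pmf p"])

lemma finite_set_replicate_pmf [simp]:
  "finite (set_pmf p) \<Longrightarrow> finite (set_pmf (replicate_pmf n p))"
  using finite_lists_length_eq[of "set_pmf p" n]
  by (simp add: set_replicate_pmf lists_eq_set conj_commute)

lemma expectation_mono_finite:
  fixes f g :: "'a \<Rightarrow> real"
  assumes "finite (set_pmf p)" "\<And>x. x \<in> set_pmf p \<Longrightarrow> f x \<le> g x"
  shows "measure_pmf.expectation p f \<le> measure_pmf.expectation p g"
  using assms by (intro integral_mono_AE integrable_measure_pmf_finite) (auto simp: AE_measure_pmf_iff)

text \<open>On the finite support, \<open>g\<close> stays in an interval of length \<open>c\<close>
  that starts at its minimum, so Hoeffding's lemma applies. Bounding the oscillation instead of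
  naming an interval suits the conditional means that occur in
  \<open>bounded_differences_mgf\<close>.\<close>

lemma hoeffding_mgf_finite_pmf:
  fixes g :: "'a \<Rightarrow> real"
  assumes fin: "finite (set_pmf p)" and l: "l > 0"
    and osc: "\<And>x y. \<bar>g x - g y\<bar> \<le> c"
  shows "measure_pmf.expectation p (\<lambda>x. exp (l * g x))
       \<le> exp (l * measure_pmf.expectation p g + l\<^sup>2 * c\<^sup>2 / 8)"
proof -
  define \<mu> where "\<mu> = measure_pmf.expectation p g"
  define a where "a = Min (g ` set_pmf p)"
  have ne: "g ` set_pmf p \<noteq> {}" by (simp add: set_pmf_not_empty)
  have c0: "c \<ge> 0" using osc[of undefined undefined] by simp
  have "a \<in> g ` set_pmf p" unfolding a_def using fin ne by (intro Min_in) auto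
  then obtain x0 where x0: "a = g x0" by auto
  have "g x \<in> {a..a+c}" if "x \<in> set_pmf p" for x
    using Min_le[of "g ` set_pmf p" "g x"] that fin osc[of x x0] by (auto simp: a_def[symmetric] x0[symmetric])
  then interpret interval_bounded_random_variable "measure_pmf p" g a "a + c"
    by unfold_locales (auto simp: AE_measure_pmf_iff)
  have "nn_integral p (\<lambda>x. exp (l * (g x - \<mu>))) \<le> ennreal (exp (l\<^sup>2 * c\<^sup>2 / 8))"
    using Hoeffdings_lemma_nn_integral[OF l] by (simp add: \<mu>_def)
  moreover have "nn_integral p (\<lambda>x. exp (l * (g x - \<mu>)))
      = ennreal (measure_pmf.expectation p (\<lambda>x. exp (l * (g x - \<mu>))))"
    using fin by (intro nn_integral_eq_integral integrable_measure_pmf_finite) auto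
  ultimately have "measure_pmf.expectation p (\<lambda>x. exp (l * (g x - \<mu>))) \<le> exp (l\<^sup>2 * c\<^sup>2 / 8)"
    by (simp add: ennreal_le_iff)
  moreover have "measure_pmf.expectation p (\<lambda>x. exp (l * g x))
      = exp (l * \<mu>) * measure_pmf.expectation p (\<lambda>x. exp (l * (g x - \<mu>)))"
    by (simp add: right_diff_distrib exp_diff)
  ultimately show ?thesis by (simp add: exp_add \<mu>_def)
qed

text \<open>Induction by conditioning on the first sample, in place of the Doob martingale: the
  conditional mean \<open>g\<close> again oscillates by at most \<open>c\<close>, and fixing the
  head of the list preserves the bounded differences. Each sample contributes one factor from
  Hoeffding's lemma.\<close>

lemma bounded_differences_mgf:
  fixes f :: "'a list \<Rightarrow> real"
  assumes fin: "finite (set_pmf p)" and l: "l > 0"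
    and bd: "\<And>xs x y ys. \<bar>f (xs @ x # ys) - f (xs @ y # ys)\<bar> \<le> c"
  shows "measure_pmf.expectation (replicate_pmf n p) (\<lambda>xs. exp (l * f xs))
       \<le> exp (l * measure_pmf.expectation (replicate_pmf n p) f + l\<^sup>2 * (real n * c\<^sup>2) / 8)"
  using bd
proof (induction n arbitrary: f)
  case 0
  then show ?case by simp
next
  case (Suc n)
  let ?R = "replicate_pmf n p"
  define g where "g = (\<lambda>x. measure_pmf.expectation ?R (\<lambda>xs. f (x # xs)))"
  have E: "measure_pmf.expectation (replicate_pmf (Suc n) p) h
      = measure_pmf.expectation p (\<lambda>x. measure_pmf.expectation ?R (\<lambda>xs. h (x # xs)))"
    for h :: "'a list \<Rightarrow> real"
    using fin by (simp add: expectation_bind_pmf_finite)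
  have int: "integrable ?R h" for h :: "'a list \<Rightarrow> real"
    using fin by (intro integrable_measure_pmf_finite) auto
  have osc: "\<bar>g x - g y\<bar> \<le> c" for x y
  proof -
    have 1: "g x - g y = measure_pmf.expectation ?R (\<lambda>xs. f (x # xs) - f (y # xs))"
      unfolding g_def using int by (simp add: Bochner_Integration.integral_diff)
    have "f (x # xs) - f (y # xs) \<le> c" "- c \<le> f (x # xs) - f (y # xs)" for xs
      using Suc.prems[of "[]" x xs y] by auto
    then have "measure_pmf.expectation ?R (\<lambda>xs. f (x # xs) - f (y # xs)) \<le> c"
      "- c \<le> measure_pmf.expectation ?R (\<lambda>xs. f (x # xs) - f (y # xs))"
      using expectation_mono_finite[of ?R "\<lambda>xs. f (x # xs) - f (y # xs)" "\<lambda>_. c"]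
        expectation_mono_finite[of ?R "\<lambda>_. -c" "\<lambda>xs. f (x # xs) - f (y # xs)"] fin by auto
    with 1 show ?thesis by linarith
  qed
  have "measure_pmf.expectation ?R (\<lambda>xs. exp (l * f (x # xs)))
      \<le> exp (l * g x + l\<^sup>2 * (real n * c\<^sup>2) / 8)" for x
    unfolding g_def using Suc.prems[of "x # _"] by (intro Suc.IH) auto
  then have "measure_pmf.expectation (replicate_pmf (Suc n) p) (\<lambda>xs. exp (l * f xs))
      \<le> measure_pmf.expectation p (\<lambda>x. exp (l * g x + l\<^sup>2 * (real n * c\<^sup>2) / 8))"
    unfolding E using fin by (intro expectation_mono_finite) auto
  also have "\<dots> = measure_pmf.expectation p (\<lambda>x. exp (l * g x)) * exp (l\<^sup>2 * (real n * c\<^sup>2) / 8)"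
    by (simp add: exp_add)
  also have "\<dots> \<le> exp (l * measure_pmf.expectation p g + l\<^sup>2 * c\<^sup>2 / 8) * exp (l\<^sup>2 * (real n * c\<^sup>2) / 8)"
    using hoeffding_mgf_finite_pmf[OF fin l osc] by (intro mult_right_mono) auto
  also have "\<dots> = exp (l * measure_pmf.expectation p g + l\<^sup>2 * (real (Suc n) * c\<^sup>2) / 8)"
    by (simp add: exp_add[symmetric] field_simps)
  finally show ?case by (simp only: E g_def)
qed

lemma McDiarmid_ge:
  fixes f :: "'a list \<Rightarrow> real"
  assumes fin: "finite (set_pmf p)" and n: "n > 0" and c: "c > 0" and t: "t \<ge> 0"
    and bd: "\<And>xs x y ys. \<bar>f (xs @ x # ys) - f (xs @ y # ys)\<bar> \<le> c"
  shows "measure_pmf.prob (replicate_pmf n p) {xs. f xs \<ge> measure_pmf.expectation (replicate_pmf n p) f + t}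
       \<le> exp (- 2 * t\<^sup>2 / (real n * c\<^sup>2))"
proof (cases "t = 0")
  case True then show ?thesis by simp
next
  case False
  let ?R = "replicate_pmf n p"
  define \<mu> where "\<mu> = measure_pmf.expectation ?R f"
  \<comment> \<open>This value of \<open>l\<close> minimises the exponent
    \<open>l\<^sup>2 * (real n * c\<^sup>2) / 8 - l * t\<close>.\<close>
  define l where "l = 4 * t / (real n * c\<^sup>2)"
  have l: "l > 0" using False t n c by (simp add: l_def)
  have "measure_pmf.prob ?R {xs. f xs \<ge> \<mu> + t}
      = measure_pmf.expectation ?R (\<lambda>xs. indicator {xs. f xs \<ge> \<mu> + t} xs)" by simp
  also have "\<dots> \<le> measure_pmf.expectation ?R (\<lambda>xs. exp (l * f xs) * exp (- l * (\<mu> + t)))"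
    using fin l by (intro expectation_mono_finite) (auto simp: indicator_def exp_add[symmetric] simp flip: right_diff_distrib)
  also have "\<dots> = measure_pmf.expectation ?R (\<lambda>xs. exp (l * f xs)) * exp (- l * (\<mu> + t))" by simp
  also have "\<dots> \<le> exp (l * \<mu> + l\<^sup>2 * (real n * c\<^sup>2) / 8) * exp (- l * (\<mu> + t))"
    unfolding \<mu>_def using bounded_differences_mgf[of p l f c n, OF fin l bd] by (intro mult_right_mono) auto
  also have "\<dots> = exp (l\<^sup>2 * (real n * c\<^sup>2) / 8 - l * t)"
    by (simp add: exp_add[symmetric] algebra_simps)
  also have "l\<^sup>2 * (real n * c\<^sup>2) / 8 - l * t = - 2 * t\<^sup>2 / (real n * c\<^sup>2)"
    using n c by (simp add: l_def field_simps power2_eq_square)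
  finally show ?thesis by (simp add: \<mu>_def)
qed

lemma McDiarmid_le:
  fixes f :: "'a list \<Rightarrow> real"
  assumes fin: "finite (set_pmf p)" and n: "n > 0" and c: "c > 0" and t: "t \<ge> 0"
    and bd: "\<And>xs x y ys. \<bar>f (xs @ x # ys) - f (xs @ y # ys)\<bar> \<le> c"
  shows "measure_pmf.prob (replicate_pmf n p) {xs. f xs \<le> measure_pmf.expectation (replicate_pmf n p) f - t}
       \<le> exp (- 2 * t\<^sup>2 / (real n * c\<^sup>2))"
proof -
  have "\<bar>- f (xs @ x # ys) - - f (xs @ y # ys)\<bar> \<le> c" for xs x y ys
    using bd[of xs x ys y] by linarith
  from McDiarmid_ge[of p n c t "\<lambda>xs. - f xs", OF fin n c t this]
  have "measure_pmf.prob (replicate_pmf n p) {xs. - measure_pmf.expectation (replicate_pmf n p) f + t \<le> - f xs}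
      \<le> exp (- 2 * t\<^sup>2 / (real n * c\<^sup>2))" by simp
  also have "{xs. - measure_pmf.expectation (replicate_pmf n p) f + t \<le> - f xs}
      = {xs. f xs \<le> measure_pmf.expectation (replicate_pmf n p) f - t}" by auto
  finally show ?thesis .
qed

section \<open>Differences of binomial distribution functions\<close>

definition binomial_cdf :: "nat \<Rightarrow> real \<Rightarrow> nat \<Rightarrow> real" where
  "binomial_cdf m r x = (\<Sum>j\<le>x. Bernstein m j r)"

text \<open>Binomial absorption turns the derivative into a difference of neighbouring polynomials
  of lower degree, which telescopes when summed over \<open>j\<close>. At \<open>j = 0\<close> there
  is no left neighbour.\<close>

lemma has_field_derivative_Bernstein_Suc:
  "((\<lambda>r. Bernstein (Suc m) j r) has_field_derivative
     real (Suc m) * ((if j = 0 then 0 else Bernstein m (j - 1) r) - Bernstein m j r)) (at r)"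
proof (cases j)
  case 0
  show ?thesis unfolding Bernstein_def 0
    by (rule derivative_eq_intros refl | simp)+
next
  case (Suc i)
  define c where "c = real (Suc m choose Suc i)"
  have c1: "c * real (Suc i) = real (Suc m) * real (m choose i)"
    unfolding c_def of_nat_mult[symmetric] by (metis Suc_times_binomial mult.commute)
  have c2: "c * real (m - i) = real (Suc m) * real (m choose Suc i)"
    unfolding c_def of_nat_mult[symmetric]
    by (metis binomial_absorb_comp diff_Suc_Suc diff_Suc_1 mult.commute)
  have "((\<lambda>r. Bernstein (Suc m) j r) has_field_derivative
     c * real (Suc i) * r ^ i * (1 - r) ^ (m - i)
     - c * real (m - i) * r ^ Suc i * (1 - r) ^ (m - i - 1)) (at r)"
    unfolding Bernstein_def Suc c_def[symmetric]
    by (rule derivative_eq_intros refl | simp add: algebra_simps)+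
  then show ?thesis unfolding c1 c2
    by (simp add: Bernstein_def Suc algebra_simps)
qed

text \<open>The sum of the derivatives telescopes to its last term. The number of trials drops by
  one, so the concentration windows below belong to \<open>m - 1\<close> trials.\<close>

lemma has_field_derivative_binomial_cdf_Suc:
  "((\<lambda>r. binomial_cdf (Suc m) r x) has_field_derivative - (real (Suc m) * Bernstein m x r)) (at r)"
  unfolding binomial_cdf_def
proof (induction x)
  case 0
  show ?case using has_field_derivative_Bernstein_Suc[of m 0 r] by simp
next
  case (Suc x)
  show ?case
    using DERIV_add[OF Suc has_field_derivative_Bernstein_Suc[of m "Suc x" r]]
    by (simp add: algebra_simps)
qed

lemma binomial_cdf_antimono:
  assumes "0 \<le> Q" "Q \<le> P" "P \<le> 1"
  shows "binomial_cdf m P x \<le> binomial_cdf m Q x"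
proof (cases m)
  case 0
  show ?thesis unfolding 0 binomial_cdf_def
  proof (intro sum_mono)
    show "Bernstein 0 j P \<le> Bernstein 0 j Q" for j by (cases j) (simp_all add: Bernstein_def)
  qed
next
  case (Suc m')
  show ?thesis
  proof (rule DERIV_nonpos_imp_nonincreasing[OF assms(2)])
    fix r assume "Q \<le> r" "r \<le> P"
    then have "0 \<le> Bernstein m' x r" using assms by (intro Bernstein_nonneg) auto
    then show "\<exists>y. ((\<lambda>r. binomial_cdf m r x) has_real_derivative y) (at r) \<and> y \<le> 0"
      using has_field_derivative_binomial_cdf_Suc[of m' x r] Suc by (intro exI) auto
  qed
qed

text \<open>The mean value theorem is applied once to the sum over the whole window, so a single
  intermediate point serves all \<open>x\<close> and the window probability is needed at that point
  only.\<close>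

lemma sum_binomial_cdf_diff_ge:
  assumes QP: "Q \<le> P" and c: "\<And>r. Q \<le> r \<Longrightarrow> r \<le> P \<Longrightarrow> c \<le> (\<Sum>x\<in>W. Bernstein m x r)"
  shows "real (Suc m) * (P - Q) * c
       \<le> (\<Sum>x\<in>W. binomial_cdf (Suc m) Q x - binomial_cdf (Suc m) P x)"
proof (cases "Q = P")
  case True then show ?thesis by simp
next
  case False
  let ?\<phi> = "\<lambda>r. \<Sum>x\<in>W. binomial_cdf (Suc m) r x"
  have "(?\<phi> has_field_derivative (\<Sum>x\<in>W. - (real (Suc m) * Bernstein m x r))) (at r)" for r
    by (intro DERIV_sum has_field_derivative_binomial_cdf_Suc)
  from MVT2[OF _ this, of Q P] False QP obtain \<xi> where \<xi>: "Q < \<xi>" "\<xi> < P"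
    "?\<phi> P - ?\<phi> Q = (P - Q) * (\<Sum>x\<in>W. - (real (Suc m) * Bernstein m x \<xi>))" by auto
  have "?\<phi> Q - ?\<phi> P = real (Suc m) * (P - Q) * (\<Sum>x\<in>W. Bernstein m x \<xi>)"
  proof -
    have *: "(\<Sum>x\<in>W. - (real (Suc m) * Bernstein m x \<xi>)) = - (real (Suc m) * (\<Sum>x\<in>W. Bernstein m x \<xi>))"
      by (simp add: sum_negf sum_distrib_left del: of_nat_Suc)
    show ?thesis using \<xi>(3) unfolding * by (simp add: algebra_simps)
  qed
  moreover have "real (Suc m) * (P - Q) * c \<le> real (Suc m) * (P - Q) * (\<Sum>x\<in>W. Bernstein m x \<xi>)"
    using \<xi> QP by (intro mult_left_mono c) auto
  ultimately show ?thesis by (simp add: sum_subtractf)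
qed

section \<open>Concentration of binomial probabilities on a window\<close>

lemma Bernstein_variance:
  "(\<Sum>x\<le>m. (real x - real m * r)\<^sup>2 * Bernstein m x r) = real m * r * (1 - r)"
proof -
  have "(\<Sum>x\<le>m. (real x - real m * r)\<^sup>2 * Bernstein m x r)
      = (\<Sum>x\<le>m. real x * (real x - 1) * Bernstein m x r)
        + (1 - 2 * (real m * r)) * (\<Sum>x\<le>m. real x * Bernstein m x r)
        + (real m * r)\<^sup>2 * (\<Sum>x\<le>m. Bernstein m x r)"
    unfolding sum_distrib_left sum.distrib[symmetric]
    by (intro sum.cong) (auto simp: algebra_simps power2_eq_square)
  then show ?thesis unfolding sum_kk_Bernstein sum_k_Bernstein sum_Bernstein
    by (simp add: algebra_simps power2_eq_square)
qed

text \<open>Chebyshev's inequality with variance at most \<open>T\<^sup>2 / 2\<close>. Since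
  \<open>W\<close> only has to contain the interval around the mean, one window can serve many
  values of \<open>m\<close> and \<open>r\<close>.\<close>

lemma Bernstein_chebyshev:
  assumes r: "0 \<le> r" "r \<le> 1" and T: "T > 0" "2 * real m * r \<le> T\<^sup>2"
    and W: "finite W" "\<And>x. x \<le> m \<Longrightarrow> \<bar>real x - real m * r\<bar> \<le> T \<Longrightarrow> x \<in> W"
  shows "1 / 2 \<le> (\<Sum>x\<in>W. Bernstein m x r)"
proof -
  have nn: "0 \<le> Bernstein m x r" for x using r by (rule Bernstein_nonneg)
  have "T\<^sup>2 * (\<Sum>x\<in>{..m} - W. Bernstein m x r)
      \<le> (\<Sum>x\<in>{..m} - W. (real x - real m * r)\<^sup>2 * Bernstein m x r)"
    unfolding sum_distrib_left
  proof (intro sum_mono mult_right_mono nn)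
    fix x assume "x \<in> {..m} - W"
    then have "T \<le> \<bar>real x - real m * r\<bar>" using W(2)[of x] by fastforce
    then show "T\<^sup>2 \<le> (real x - real m * r)\<^sup>2"
      using T by (intro abs_le_square_iff[THEN iffD1]) auto
  qed
  also have "\<dots> \<le> (\<Sum>x\<le>m. (real x - real m * r)\<^sup>2 * Bernstein m x r)"
    by (intro sum_mono2) (auto simp: nn)
  also have "\<dots> \<le> T\<^sup>2 * (1 / 2)"
  proof -
    have "real m * r * (1 - r) \<le> real m * r * 1" using r by (intro mult_left_mono) auto
    with T show ?thesis by (simp add: Bernstein_variance)
  qed
  finally have 1: "(\<Sum>x\<in>{..m} - W. Bernstein m x r) \<le> 1 / 2"
    using T by (simp add: mult_le_cancel_left_pos del: mult_le_cancel_left)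
  have "1 = (\<Sum>x\<in>{..m} - W. Bernstein m x r) + (\<Sum>x\<in>{..m} \<inter> W. Bernstein m x r)"
    using sum.Int_Diff[of "{..m}" "\<lambda>x. Bernstein m x r" W] by simp
  also have "(\<Sum>x\<in>{..m} \<inter> W. Bernstein m x r) \<le> (\<Sum>x\<in>W. Bernstein m x r)"
    using W(1) by (intro sum_mono2) (auto simp: nn)
  finally show ?thesis using 1 by simp
qed

lemma card_real_interval_nat_le:
  assumes "a \<le> b"
  shows "finite {x::nat. a \<le> real x \<and> real x \<le> b}" "real (card {x::nat. a \<le> real x \<and> real x \<le> b}) \<le> b - a + 1"
proof -
  let ?S = "{x::nat. a \<le> real x \<and> real x \<le> b}"
  have sub: "int ` ?S \<subseteq> {\<lceil>a\<rceil>..\<lfloor>b\<rfloor>}" by (auto simp: ceiling_le_iff le_floor_iff)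
  show fin: "finite ?S" using finite_subset[OF sub] by (auto dest: finite_imageD)
  have "card ?S = card (int ` ?S)" by (simp add: card_image)
  also have "\<dots> \<le> card {\<lceil>a\<rceil>..\<lfloor>b\<rfloor>}" using sub by (intro card_mono) auto
  also have "\<dots> = nat (\<lfloor>b\<rfloor> - \<lceil>a\<rceil> + 1)" by simp
  finally have "real (card ?S) \<le> real (nat (\<lfloor>b\<rfloor> - \<lceil>a\<rceil> + 1))" by simp
  also have "\<dots> \<le> b - a + 1"
    using assms le_of_int_ceiling[of a] of_int_floor_le[of b] by linarith
  finally show "real (card ?S) \<le> b - a + 1" .
qed

text \<open>
  Cauchy--Schwarz on a window \<open>W\<close> of values \<open>x\<close> that contains every mean
  \<open>(m - 1) * r\<close> with \<open>Q \<le> r \<le> P\<close> and \<open>m\<close> in \<open>{k-t..k}\<close>, widened by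
  \<open>sqrt (2 * k * P)\<close> so that Chebyshev's inequality applies to all of them at once.
\<close>

lemma sum_square_averaged_cdf_diff_ge:
  fixes k t K :: nat and P Q :: real
  assumes k: "k \<ge> 1" "16 * t\<^sup>2 \<le> k" "k \<le> K" and PQ: "0 \<le> Q" "Q \<le> P" "P \<le> 1"
  shows "(real t + 1)\<^sup>2 * (real k * (P - Q))\<^sup>2 / (32 * (1 + sqrt (real k * P) + real k * (P - Q)))
       \<le> (\<Sum>x<K. (\<Sum>m=k-t..k. binomial_cdf m Q x - binomial_cdf m P x)\<^sup>2)"
proof (cases "P = Q")
  case True then show ?thesis by simp
next
  case False
  define A where "A m x = binomial_cdf m Q x - binomial_cdf m P x" for m x
  define \<Delta> where "\<Delta> = real k * (P - Q)"
  define \<mu> where "\<mu> = real k * P"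
  have P0: "P > 0" using False PQ by simp
  have D0: "\<Delta> > 0" using False PQ k by (simp add: \<Delta>_def)
  have l0: "\<mu> > 0" using P0 k by (simp add: \<mu>_def)
  define T where "T = sqrt (2 * \<mu>)"
  have T: "T > 0" using l0 by (simp add: T_def)
  have tk: "4 * real t \<le> sqrt (real k)"
  proof -
    have "(4 * real t)\<^sup>2 = real (16 * t\<^sup>2)" by (simp add: power_mult_distrib)
    also have "\<dots> \<le> real k" using k(2) by (rule of_nat_mono)
    finally show ?thesis using real_le_rsqrt by blast
  qed
  have sk: "sqrt (real k) \<le> real k"
    using k(1) by (intro real_le_lsqrt) (auto simp: power2_eq_square)
  have tk': "4 * real t \<le> real k" using tk sk by simp
  define lo where "lo = (real k - real t - 1) * Q - T"
  define hi where "hi = \<mu> + T"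
  define W where "W = {x::nat. lo \<le> real x \<and> real x \<le> hi} \<inter> {..<K}"
  \<comment> \<open>Varying the number of trials over \<open>k - t\<close> to \<open>k\<close> moves
    the mean by at most \<open>t * Q\<close>. As \<open>t\<close> is at most
    \<open>sqrt k / 4\<close>, this drift stays below the fluctuation scale
    \<open>sqrt \<mu>\<close>, so the common window remains short.\<close>
  have tQ: "real t * Q \<le> sqrt \<mu> / 4"
  proof -
    have "Q \<le> sqrt P"
    proof -
      have "P\<^sup>2 \<le> P" using PQ P0 by (simp add: power2_eq_square mult_left_le)
      then have "P \<le> sqrt P" by (rule real_le_rsqrt)
      with PQ show ?thesis by simp
    qed
    then have "(4 * real t) * Q \<le> sqrt (real k) * sqrt P"
      using tk PQ by (intro mult_mono) auto
    then show ?thesis by (simp add: \<mu>_def real_sqrt_mult)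
  qed
  have T3: "T \<le> 3/2 * sqrt \<mu>"
    unfolding T_def real_sqrt_mult using sqrt2_less_2 l0
    by (intro mult_right_mono real_le_lsqrt) (auto simp: power2_eq_square)
  have lohi: "hi - lo = \<Delta> + real t * Q + Q + 2 * T"
    by (simp add: hi_def lo_def \<mu>_def \<Delta>_def algebra_simps)
  have lohi': "lo \<le> hi" using lohi D0 T PQ by (smt (verit) mult_nonneg_nonneg of_nat_0_le_iff)
  have Wfin: "finite W" by (simp add: W_def)
  have Wcard: "real (card W) \<le> 4 * (1 + sqrt \<mu> + \<Delta>)"
  proof -
    have "card W \<le> card {x::nat. lo \<le> real x \<and> real x \<le> hi}"
      unfolding W_def using card_real_interval_nat_le(1)[OF lohi'] by (intro card_mono) auto
    also have "real \<dots> \<le> hi - lo + 1" using card_real_interval_nat_le(2)[OF lohi'] .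
    also have "\<dots> \<le> \<Delta> + sqrt \<mu> / 4 + 1 + 3 * sqrt \<mu> + 1" unfolding lohi using tQ T3 PQ by linarith
    also have "\<dots> \<le> 4 * (1 + sqrt \<mu> + \<Delta>)" using D0 l0 by (simp add: algebra_simps)
    finally show ?thesis by simp
  qed
  have SA: "3 / 8 * \<Delta> \<le> (\<Sum>x\<in>W. A m x)" if m: "m \<in> {k-t..k}" for m
  proof -
    have mr: "real k - real t \<le> real m" "m \<le> k" using m by auto
    then have "m > 0" using tk' k(1) by (cases m) auto
    then obtain m' where m': "m = Suc m'" by (cases m) auto
    have half: "1 / 2 \<le> (\<Sum>x\<in>W. Bernstein m' x r)" if r: "Q \<le> r" "r \<le> P" for r
    proof (rule Bernstein_chebyshev[OF _ _ T _ Wfin])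
      show r01: "0 \<le> r" "r \<le> 1" using r PQ by auto
      have m'r: "real m' * r \<le> \<mu>" unfolding \<mu>_def using r r01 mr m' by (intro mult_mono) auto
      then show "2 * real m' * r \<le> T\<^sup>2" using l0 by (simp add: T_def)
      have lor: "(real k - real t - 1) * Q \<le> real m' * r"
        using mr m' r PQ by (intro mult_mono) auto
      fix x assume x: "x \<le> m'" "\<bar>real x - real m' * r\<bar> \<le> T"
      then have "lo \<le> real x" "real x \<le> hi" using lor m'r by (auto simp: lo_def hi_def abs_le_iff)
      moreover have "x < K" using x m' mr k by simp
      ultimately show "x \<in> W" by (simp add: W_def)
    qed
    \<comment> \<open>The factor \<open>3 / 4\<close> comes from
      \<open>m >= k - t >= 3 * k / 4\<close>, the factor \<open>1/2\<close> from Chebyshev.\<close>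
    have "3 / 8 * \<Delta> = (3 / 4 * real k) * (P - Q) * (1/2)" by (simp add: \<Delta>_def)
    also have "\<dots> \<le> real (Suc m') * (P - Q) * (1/2)"
      using mr tk' m' PQ by (intro mult_right_mono) auto
    also have "\<dots> \<le> (\<Sum>x\<in>W. A m x)"
      unfolding A_def m' by (rule sum_binomial_cdf_diff_ge[OF PQ(2) half])
    finally show ?thesis .
  qed
  have ck: "card {k-t..k} = t + 1" using tk' by simp
  have "(real t + 1) * (3 / 8 * \<Delta>) = (\<Sum>m=k-t..k. 3 / 8 * \<Delta>)" using ck by simp
  also have "\<dots> \<le> (\<Sum>m=k-t..k. \<Sum>x\<in>W. A m x)" by (intro sum_mono SA)
  also have "\<dots> = (\<Sum>x\<in>W. \<Sum>m=k-t..k. A m x)" by (rule sum.swap)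
  finally have S: "(real t + 1) * (3 / 8 * \<Delta>) \<le> (\<Sum>x\<in>W. \<Sum>m=k-t..k. A m x)" .
  have square_eq: "((real t + 1) * (3 / 8 * \<Delta>))\<^sup>2 = (real t + 1)\<^sup>2 * \<Delta>\<^sup>2 * (9/64)"
    by (simp add: power_mult_distrib power_divide)
  have "((real t + 1) * (3 / 8 * \<Delta>))\<^sup>2 \<le> (\<Sum>x\<in>W. \<Sum>m=k-t..k. A m x)\<^sup>2"
    using S D0 by (intro power_mono) auto
  also have "\<dots> \<le> (\<Sum>x\<in>W. (\<Sum>m=k-t..k. A m x)\<^sup>2) * real (card W)"
    using Cauchy_Schwarz_ineq_sum[of "\<lambda>x. \<Sum>m=k-t..k. A m x" "\<lambda>_. 1" W] by simp
  also have "\<dots> \<le> (\<Sum>x<K. (\<Sum>m=k-t..k. A m x)\<^sup>2) * (4 * (1 + sqrt \<mu> + \<Delta>))"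
    using Wcard by (intro mult_mono sum_mono2 sum_nonneg) (auto simp: W_def)
  finally have "(real t + 1)\<^sup>2 * \<Delta>\<^sup>2 * (9/64) \<le> (\<Sum>x<K. (\<Sum>m=k-t..k. A m x)\<^sup>2) * (4 * (1 + sqrt \<mu> + \<Delta>))"
    unfolding square_eq .
  moreover have "0 \<le> (real t + 1)\<^sup>2 * \<Delta>\<^sup>2" by simp
  \<comment> \<open>The exact constant is \<open>4 * 64 / 9 = 256 / 9\<close>, rounded up to
    \<open>32\<close>.\<close>
  ultimately have "(real t + 1)\<^sup>2 * \<Delta>\<^sup>2 \<le> (\<Sum>x<K. (\<Sum>m=k-t..k. A m x)\<^sup>2) * (32 * (1 + sqrt \<mu> + \<Delta>))"
    by linarith
  moreover have "0 < 32 * (1 + sqrt \<mu> + \<Delta>)" using D0 l0 by (smt (verit) real_sqrt_ge_zero)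
  ultimately show ?thesis
    by (simp add: pos_divide_le_eq \<Delta>_def \<mu>_def A_def)
qed

section \<open>Central trinomial probabilities\<close>

text \<open>
  \<open>trinomial_prob N a b\<close> is the probability that two given categories of \<open>N\<close> uniform draws
  from four categories receive \<open>a\<close> and \<open>b\<close> draws; the powers of four and two are combined so that
  \<open>N - a - b\<close> does not occur.
\<close>

definition trinomial_prob :: "nat \<Rightarrow> nat \<Rightarrow> nat \<Rightarrow> real" where
  "trinomial_prob N a b = real (N choose (a + b)) * real ((a + b) choose a) / (2 ^ N * 2 ^ (a + b))"

lemma trinomial_prob_nonneg: "0 \<le> trinomial_prob N a b"
  by (simp add: trinomial_prob_def)

lemma trinomial_prob_commute: "trinomial_prob N a b = trinomial_prob N b a"
  using binomial_symmetric[of a "a + b"] by (simp add: trinomial_prob_def add.commute)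

lemma trinomial_prob_0: "trinomial_prob 0 a b = (if a = 0 \<and> b = 0 then 1 else 0)"
  by (auto simp: trinomial_prob_def)

text \<open>Conditioning on one further draw: each of the two observed categories has probability
  \<open>1/4\<close>, the other two together \<open>1/2\<close>. With Pascal's rule this recurrence
  follows from the closed formula; it later identifies the joint law of two sample sizes.\<close>

lemma trinomial_prob_Suc:
  "trinomial_prob (Suc N) a b =
     (if a = 0 then 0 else trinomial_prob N (a - 1) b) / 4
     + (if b = 0 then 0 else trinomial_prob N a (b - 1)) / 4 + trinomial_prob N a b / 2"
proof (cases a; cases b)
  fix i j assume "a = Suc i" "b = Suc j"
  moreover have "real (Suc (i + j) choose i) + real (Suc (i + j) choose Suc i) = real (Suc (Suc (i + j)) choose Suc i)"
    by simp
  ultimately show ?thesis by (simp add: trinomial_prob_def field_simps)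
qed (auto simp: trinomial_prob_def field_simps)

lemma trinomial_prob_step:
  assumes "a + b < N"
  shows "trinomial_prob N a b = trinomial_prob N (Suc a) b * (2 * real (Suc a) / real (N - (a + b)))"
proof -
  define s where "s = a + b"
  have "(N choose Suc s) * (Suc s choose Suc a) * Suc a = (N choose s) * (N - s) * (s choose a)"
    by (metis Suc_times_binomial_eq binomial_absorb_comp binomial_absorption mult.assoc mult.commute)
  then have 1: "real (N choose Suc s) * real (Suc s choose Suc a) * real (Suc a)
      = real (N choose s) * real (N - s) * real (s choose a)"
    by (metis of_nat_mult)
  have "trinomial_prob N (Suc a) b * (2 * real (Suc a) / real (N - (a + b)))
      = (real (N choose Suc s) * real (Suc s choose Suc a) * real (Suc a)) / (2 ^ N * 2 ^ s * real (N - s))"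
    by (simp add: trinomial_prob_def s_def[symmetric] del: of_nat_Suc binomial_Suc_Suc)
  also have "\<dots> = trinomial_prob N a b"
    unfolding 1 using assms by (simp add: trinomial_prob_def s_def[symmetric])
  finally show ?thesis by simp
qed

text \<open>The squared inequality is free of roots and can be proved by induction, where the step
  comes down to \<open>4 * j * (j + 1) <= (2 * j + 1)\<^sup>2\<close>.\<close>

lemma central_binomial_ge_sqrt:
  assumes "j \<ge> 1"
  shows "1 / (2 * sqrt (real j)) \<le> real ((2 * j) choose j) / 4 ^ j"
proof -
  have "(16::real) ^ j \<le> (real ((2 * j) choose j))\<^sup>2 * (4 * real j)"
    using assms
  proof (induction j rule: dec_induct)
    case base
    show ?case by (simp add: binomial_Suc_n numeral_2_eq_2[symmetric])
  next
    case (step j)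
    let ?C = "real ((2 * j) choose j)"
    have "(Suc j) * (Suc (Suc (2 * j)) choose Suc j) = Suc (Suc (2 * j)) * (Suc (2 * j) choose j)"
      by (rule Suc_times_binomial)
    moreover have "(Suc (2 * j) choose j) * Suc j = Suc (2 * j) * (2 * j choose j)"
      using binomial_absorb_comp[of "Suc (2 * j)" j] by (simp add: mult.commute)
    ultimately have "(Suc j) * (Suc (Suc (2 * j)) choose Suc j) = 2 * (Suc (2 * j) * (2 * j choose j))"
      by (simp add: algebra_simps)
    then have "real (Suc j) * real ((2 * Suc j) choose Suc j) = 2 * real (Suc (2 * j)) * ?C"
      by (metis (no_types, opaque_lifting) mult.assoc mult_2_right add_Suc add_Suc_right mult_2 of_nat_mult of_nat_numeral)
    then have C': "real ((2 * Suc j) choose Suc j) = 2 * real (Suc (2 * j)) * ?C / real (Suc j)"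
      by (simp add: field_simps)
    have "(16::real) ^ Suc j \<le> 16 * (?C\<^sup>2 * (4 * real j))"
      unfolding power_Suc by (intro mult_left_mono step.IH) simp
    also have "\<dots> \<le> 16 * (?C\<^sup>2 * ((real (Suc (2 * j)))\<^sup>2 / real (Suc j)))"
      by (intro mult_left_mono) (auto simp: field_simps power2_eq_square)
    also have "\<dots> = (2 * real (Suc (2 * j)) * ?C / real (Suc j))\<^sup>2 * (4 * real (Suc j))"
    proof -
      have "16 * (c\<^sup>2 * (x\<^sup>2 / y)) = (2 * x * c / y)\<^sup>2 * (4 * y)" if "y \<noteq> 0" for c x y :: real
        using that by (simp add: field_simps power2_eq_square)
      then show ?thesis by simp
    qed
    finally show ?case unfolding C' .
  qed
  then have "sqrt ((16::real) ^ j) \<le> sqrt ((real ((2 * j) choose j))\<^sup>2 * (4 * real j))" by simp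
  also have "\<dots> = real ((2 * j) choose j) * (2 * sqrt (real j))" by (simp add: real_sqrt_mult)
  also have "sqrt ((16::real) ^ j) = 4 ^ j" by (simp add: real_sqrt_power)
  finally show ?thesis using assms by (simp add: field_simps)
qed

text \<open>The central value factors into two central binomial probabilities, for
  \<open>4 * k\<close> and for \<open>2 * k\<close> trials. Each is of order
  \<open>1 / sqrt k\<close>.\<close>

lemma trinomial_prob_center_ge:
  assumes "k \<ge> 1"
  shows "1 / (6 * real k) \<le> trinomial_prob (4 * k) k k"
proof -
  have "(4::real) ^ m = 2 ^ (2 * m)" for m by (simp add: power_mult)
  from this[of "2 * k"] this[of k] have e1: "(4::real) ^ (2 * k) = 2 ^ (4 * k)" "(4::real) ^ k = 2 ^ (k + k)"
    by (simp_all add: mult_2)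
  have e: "trinomial_prob (4 * k) k k
      = (real ((2 * (2 * k)) choose (2 * k)) / 4 ^ (2 * k)) * (real ((2 * k) choose k) / 4 ^ k)"
  proof -
    have *: "2 * (2 * k) = 4 * k" by simp
    show ?thesis unfolding e1 * by (simp add: trinomial_prob_def flip: mult_2)
  qed
  have s2: "2 * sqrt 2 \<le> (3::real)"
    using real_sqrt_le_mono[of 8 9] real_sqrt_mult[of 4 2] by simp
  have "4 * sqrt 2 * real k \<le> 6 * real k" using s2 by (intro mult_right_mono) auto
  then have "1 / (6 * real k) \<le> 1 / (4 * sqrt 2 * real k)"
    using assms by (intro divide_left_mono) auto
  also have "\<dots> = (1 / (2 * sqrt (real (2 * k)))) * (1 / (2 * sqrt (real k)))"
    by (simp add: real_sqrt_mult)
  also have "\<dots> \<le> trinomial_prob (4 * k) k k"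
    unfolding e using assms by (intro mult_mono central_binomial_ge_sqrt) auto
  finally show ?thesis .
qed

text \<open>From the centre, at most \<open>2 * t\<close> unit steps reach \<open>(a, b)\<close>,
  and each loses at most a factor \<open>\<rho>\<close>. By Bernoulli's inequality the total loss is
  at most a factor \<open>3/4\<close>. Expressing the bound through \<open>t + 1\<close> makes it
  comparable to the uniform law on the square.\<close>

lemma trinomial_prob_near_center_ge:
  assumes k: "k \<ge> 1" "16 * t\<^sup>2 \<le> k" "k \<le> 16 * (t + 1)\<^sup>2" and ab: "a \<in> {k-t..k}" "b \<in> {k-t..k}"
  shows "1 / (128 * (real t + 1)\<^sup>2) \<le> trinomial_prob (4 * k) a b"
proof -
  have "t * 1 \<le> t * (16 * t)" by (cases t) auto
  also have "\<dots> \<le> k" using k(2) by (simp add: power2_eq_square)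
  finally have tk: "t \<le> k" by simp
  define \<rho> where "\<rho> = (real k - real t) / (real k + real t)"
  have \<rho>: "0 \<le> \<rho>" "\<rho> \<le> 1" using tk k by (auto simp: \<rho>_def)
  \<comment> \<open>Within the square, \<open>a + 1 >= k - t\<close> and
    \<open>4 * k - (a + b) <= 2 * (k + t)\<close>.\<close>
  have step: "\<rho> * trinomial_prob (4 * k) (Suc a) b \<le> trinomial_prob (4 * k) a b"
    if "k - t \<le> a" "a < k" "k - t \<le> b" "b \<le> k" for a b
  proof -
    have "real (4 * k - (a + b)) = 4 * real k - real a - real b" using that by (simp add: of_nat_diff)
    moreover have "real k - real t \<le> real a" "real k - real t \<le> real b" using that by auto
    ultimately have "2 * (real k - real t) / (2 * (real k + real t)) \<le> 2 * real (Suc a) / real (4 * k - (a + b))"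
      using that tk k by (intro frac_le) auto
    then have "\<rho> \<le> 2 * real (Suc a) / real (4 * k - (a + b))" unfolding \<rho>_def mult_divide_mult_cancel_left_if by simp
    then show ?thesis
      using mult_left_mono[of \<rho> "2 * real (Suc a) / real (4 * k - (a + b))" "trinomial_prob (4 * k) (Suc a) b"]
        trinomial_prob_step[of a b "4 * k"] that trinomial_prob_nonneg[of "4 * k" "Suc a" b]
      by (simp only: mult.commute[of \<rho>])
  qed
  have iter: "\<rho> ^ i * trinomial_prob (4 * k) k b \<le> trinomial_prob (4 * k) (k - i) b"
    if "i \<le> t" "k - t \<le> b" "b \<le> k" for i b
    using that(1)
  proof (induction i)
    case 0 then show ?case by simp
  next
    case (Suc i)
    have "\<rho> ^ Suc i * trinomial_prob (4 * k) k b \<le> \<rho> * trinomial_prob (4 * k) (k - i) b"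
      using Suc \<rho> by (simp add: mult.assoc mult_left_mono)
    also have "\<dots> \<le> trinomial_prob (4 * k) (k - Suc i) b"
      using step[of "k - Suc i" b] Suc.prems tk that by (simp add: Suc_diff_Suc)
    finally show ?case .
  qed
  define i j where "i = k - a" and "j = k - b"
  have ij: "a = k - i" "b = k - j" "i \<le> t" "j \<le> t" using ab by (auto simp: i_def j_def)
  have "3 / 4 \<le> \<rho> ^ (2 * t)"
  proof -
    have e: "\<rho> = 1 + (- (2 * real t / (real k + real t)))" using k by (simp add: \<rho>_def field_simps)
    have "2 * real t \<le> 1 * (real k + real t)" using tk by simp
    then have h: "2 * real t / (real k + real t) \<le> 1" using k by (subst pos_divide_le_eq) auto
    have "16 * (real t)\<^sup>2 \<le> real k" using of_nat_mono[OF k(2), where 'a = real] by simp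
    then have "4 * (real t)\<^sup>2 / (real k + real t) \<le> 1 / 4"
      using k by (subst pos_divide_le_eq) auto
    then have "3 / 4 \<le> 1 + real (2 * t) * (- (2 * real t / (real k + real t)))"
      by (simp add: power2_eq_square field_simps)
    also have "\<dots> \<le> \<rho> ^ (2 * t)"
      unfolding e using h by (intro Bernoulli_inequality) auto
    finally show ?thesis .
  qed
  also have "\<dots> \<le> \<rho> ^ (i + j)" using \<rho> ij by (intro power_decreasing) auto
  finally have 34: "3 / 4 \<le> \<rho> ^ (i + j)" .
  have "1 / (128 * (real t + 1)\<^sup>2) \<le> 1 / (8 * real k)"
  proof (rule divide_left_mono)
    have "real k \<le> 16 * (real t + 1)\<^sup>2"
      using of_nat_mono[OF k(3), where 'a = real] by (simp add: add.commute)
    then show "8 * real k \<le> 128 * (real t + 1)\<^sup>2" by simp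
  qed (use k in auto)
  also have "\<dots> = 3 / 4 * (1 / (6 * real k))" by simp
  also have "\<dots> \<le> \<rho> ^ (i + j) * trinomial_prob (4 * k) k k"
    using k by (intro mult_mono 34 trinomial_prob_center_ge) (auto simp: \<rho>)
  also have "\<dots> = \<rho> ^ i * (\<rho> ^ j * trinomial_prob (4 * k) k k)" by (simp add: power_add mult_ac)
  also have "\<dots> \<le> \<rho> ^ i * trinomial_prob (4 * k) (k - j) k"
    using iter[of j k] ij \<rho> by (intro mult_left_mono) auto
  \<comment> \<open>Symmetry lets \<open>iter\<close>, which lowers only the first argument, be used
    for the second one as well.\<close>
  also have "\<dots> = \<rho> ^ i * trinomial_prob (4 * k) k b" by (subst trinomial_prob_commute) (simp add: ij)
  also have "\<dots> \<le> trinomial_prob (4 * k) a b" using iter[of i b] ij ab by auto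
  finally show ?thesis .
qed

section \<open>The tester as a function of labelled samples\<close>

definition labelled_sample_pmf :: "'a pmf \<Rightarrow> 'a pmf \<Rightarrow> (nat \<times> 'a) pmf" where
  "labelled_sample_pmf p q = do {
     c \<leftarrow> pmf_of_set {1..4::nat};
     x \<leftarrow> (if c \<le> 2 then p else q);
     return_pmf (c, x)
   }"

definition samples_in :: "nat \<Rightarrow> (nat \<times> 'a) list \<Rightarrow> 'a multiset" where
  "samples_in c l = mset (map snd (filter (\<lambda>z. fst z = c) l))"

definition four_samples :: "(nat \<times> 'a) list \<Rightarrow> 'a multiset \<times> 'a multiset \<times> 'a multiset \<times> 'a multiset" where
  "four_samples l = (samples_in 1 l, samples_in 2 l, samples_in 3 l, samples_in 4 l)"

definition four_samples_pmf ::
  "(nat \<Rightarrow> nat) \<Rightarrow> 'a pmf \<Rightarrow> 'a pmf \<Rightarrow> ('a multiset \<times> 'a multiset \<times> 'a multiset \<times> 'a multiset) pmf" where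
  "four_samples_pmf m p q = do {
     S \<leftarrow> sample_multiset (m 1) p;
     S' \<leftarrow> sample_multiset (m 2) p;
     T \<leftarrow> sample_multiset (m 3) q;
     T' \<leftarrow> sample_multiset (m 4) q;
     return_pmf (S, S', T, T')
   }"

lemma set_pmf_of_four [simp]: "set_pmf (pmf_of_set {1..4::nat}) = {1..4}"
  by (rule set_pmf_of_set) auto

lemma sample_multiset_0: "sample_multiset 0 p = return_pmf {#}"
  by (simp add: sample_multiset_def)

lemma sample_multiset_Suc:
  "sample_multiset (Suc m) p = do {M \<leftarrow> sample_multiset m p; x \<leftarrow> p; return_pmf (add_mset x M)}"
  unfolding sample_multiset_def
  by (simp add: map_pmf_def bind_assoc_pmf bind_return_pmf bind_commute_pmf[of p])

lemma multinomial_pmf_0: "multinomial_pmf 0 w = return_pmf (\<lambda>_. 0)"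
  by (simp add: multinomial_pmf_def fun_eq_iff)

lemma multinomial_pmf_Suc:
  "multinomial_pmf (Suc N) w = do {c \<leftarrow> w; m \<leftarrow> multinomial_pmf N w; return_pmf (m(c := Suc (m c)))}"
proof -
  have "count_list (c # cs) = (count_list cs)(c := Suc (count_list cs c))" for c :: 'a and cs
    by (auto simp: fun_eq_iff)
  then show ?thesis
    by (simp add: multinomial_pmf_def map_pmf_def bind_assoc_pmf bind_return_pmf)
qed

lemma finite_set_multinomial_pmf [simp]:
  "finite (set_pmf w) \<Longrightarrow> finite (set_pmf (multinomial_pmf N w))"
  by (induction N) (auto simp: multinomial_pmf_0 multinomial_pmf_Suc)

lemma multinomial_pmf_le: "m \<in> set_pmf (multinomial_pmf N w) \<Longrightarrow> m c \<le> N"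
  by (auto simp: multinomial_pmf_def set_replicate_pmf intro: order.trans[OF count_le_length])

lemma finite_set_sample_multiset [simp]:
  "finite (set_pmf p) \<Longrightarrow> finite (set_pmf (sample_multiset m p))"
  by (induction m) (auto simp: sample_multiset_0 sample_multiset_Suc)

lemma size_sample_multiset: "M \<in> set_pmf (sample_multiset m p) \<Longrightarrow> size M = m"
  by (auto simp: sample_multiset_def set_replicate_pmf)

text \<open>One more sample in category \<open>c\<close> can be drawn after all the others. The
  commutation instances in the proof only move the extra draw past later blocks, so rewriting cannot
  swap back.\<close>

lemma four_samples_pmf_Suc:
  assumes "c \<in> {1..4}"
  shows "four_samples_pmf (m(c := Suc (m c))) p q = do {
     (S, S', T, T') \<leftarrow> four_samples_pmf m p q;
     x \<leftarrow> (if c \<le> 2 then p else q);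
     return_pmf (if c = 1 then add_mset x S else S, if c = 2 then add_mset x S' else S',
                 if c = 3 then add_mset x T else T, if c = 4 then add_mset x T' else T')
   }"
proof -
  have "{1..4::nat} = {1, 2, 3, 4}" by auto
  then consider "c = 1" | "c = 2" | "c = 3" | "c = 4" using assms by auto
  then show ?thesis
    by cases (simp_all add: four_samples_pmf_def sample_multiset_Suc bind_assoc_pmf bind_return_pmf
        bind_commute_pmf[of p "sample_multiset (m 2) p"] bind_commute_pmf[of p "sample_multiset (m 3) q"]
        bind_commute_pmf[of p "sample_multiset (m 4) q"] bind_commute_pmf[of q "sample_multiset (m 4) q"])
qed

text \<open>Drawing the sample sizes first and the samples afterwards has the same law as giving
  each of \<open>N\<close> independent samples its own random label. This is what makes the tester a
  function of independent inputs. In the induction, a new label raises one sample size and its value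
  joins the corresponding multiset.\<close>

lemma four_samples_pmf_multinomial:
  "multinomial_pmf N (pmf_of_set {1..4}) \<bind> (\<lambda>m. four_samples_pmf m p q)
   = map_pmf four_samples (replicate_pmf N (labelled_sample_pmf p q))"
proof (induction N)
  case 0
  show ?case
    by (simp add: multinomial_pmf_0 bind_return_pmf four_samples_pmf_def sample_multiset_0
        four_samples_def samples_in_def)
next
  case (Suc N)
  let ?w = "pmf_of_set {1..4::nat}" and ?R = "replicate_pmf N (labelled_sample_pmf p q)"
  let ?law = "\<lambda>c. if c \<le> 2 then p else q"
  let ?add = "\<lambda>c x (S, S', T, T'). (if c = 1 then add_mset x S else S, if c = 2 then add_mset x S' else S',
     if c = 3 then add_mset x T else T, if c = (4::nat) then add_mset x T' else T')"
  have add: "?add c x (four_samples l) = four_samples ((c, x) # l)" for c and x :: 'a and l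
    by (simp add: four_samples_def samples_in_def)
  have "multinomial_pmf (Suc N) ?w \<bind> (\<lambda>m. four_samples_pmf m p q)
      = ?w \<bind> (\<lambda>c. multinomial_pmf N ?w \<bind> (\<lambda>m. four_samples_pmf (m(c := Suc (m c))) p q))"
    by (simp add: multinomial_pmf_Suc bind_assoc_pmf bind_return_pmf)
  also have "\<dots> = ?w \<bind> (\<lambda>c. multinomial_pmf N ?w \<bind> (\<lambda>m. four_samples_pmf m p q \<bind>
      (\<lambda>t. ?law c \<bind> (\<lambda>x. return_pmf (?add c x t)))))"
    by (intro bind_pmf_cong refl) (subst four_samples_pmf_Suc, simp_all add: case_prod_beta' del: atLeastAtMost_iff)
  also have "\<dots> = ?w \<bind> (\<lambda>c. (multinomial_pmf N ?w \<bind> (\<lambda>m. four_samples_pmf m p q)) \<bind>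
      (\<lambda>t. ?law c \<bind> (\<lambda>x. return_pmf (?add c x t))))"
    by (simp only: bind_assoc_pmf)
  also have "\<dots> = ?w \<bind> (\<lambda>c. ?R \<bind> (\<lambda>l. ?law c \<bind> (\<lambda>x. return_pmf (four_samples ((c, x) # l)))))"
    unfolding Suc.IH bind_map_pmf add ..
  also have "\<dots> = ?w \<bind> (\<lambda>c. ?law c \<bind> (\<lambda>x. ?R \<bind> (\<lambda>l. return_pmf (four_samples ((c, x) # l)))))"
    by (subst bind_commute_pmf) rule
  also have "\<dots> = map_pmf four_samples (replicate_pmf (Suc N) (labelled_sample_pmf p q))"
    by (simp add: map_pmf_def labelled_sample_pmf_def bind_assoc_pmf bind_return_pmf)
  finally show ?case .
qed

section \<open>The statistic on labelled samples and its bounded differences\<close>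

definition labelled_statistic :: "nat \<Rightarrow> (nat \<times> nat) list \<Rightarrow> int" where
  "labelled_statistic n l = test_statistic n (histogram (samples_in 1 l)) (histogram (samples_in 2 l))
     (histogram (samples_in 3 l)) (histogram (samples_in 4 l))"

lemma closeness_tester_conv_labelled:
  "closeness_tester c n k \<delta> p q =
     map_pmf (\<lambda>l. if real_of_int (labelled_statistic n l) \<le> c * sqrt (real k * ln (1 / \<delta>)) then YES else NO)
       (replicate_pmf (4 * k) (labelled_sample_pmf p q))"
proof -
  let ?out = "\<lambda>(S, S', T, T'). return_pmf
     (if real_of_int (test_statistic n (histogram S) (histogram S') (histogram T) (histogram T'))
         \<le> c * sqrt (real k * ln (1 / \<delta>)) then YES else NO)"
  have "closeness_tester c n k \<delta> p q
      = (multinomial_pmf (4 * k) (pmf_of_set {1..4}) \<bind> (\<lambda>m. four_samples_pmf m p q)) \<bind> ?out"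
    by (simp add: closeness_tester_def four_samples_pmf_def Let_def bind_assoc_pmf bind_return_pmf)
  also have "\<dots> = map_pmf (\<lambda>l. if real_of_int (labelled_statistic n l) \<le> c * sqrt (real k * ln (1 / \<delta>)) then YES else NO)
       (replicate_pmf (4 * k) (labelled_sample_pmf p q))"
    unfolding four_samples_pmf_multinomial bind_map_pmf
    by (simp add: four_samples_def labelled_statistic_def map_pmf_def)
  finally show ?thesis .
qed

lemma finite_set_labelled_sample_pmf [simp]:
  "finite (set_pmf p) \<Longrightarrow> finite (set_pmf q) \<Longrightarrow> finite (set_pmf (labelled_sample_pmf p q))"
  by (auto simp: labelled_sample_pmf_def)

text \<open>One sample changes one entry of one histogram by one, and each histogram occurs in
  exactly two of the four absolute values. A replacement is a removal followed by an insertion,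
  hence the constant \<open>4\<close> in the next lemma.\<close>

lemma labelled_statistic_insert:
  "\<bar>labelled_statistic n (xs @ z # ys) - labelled_statistic n (xs @ ys)\<bar> \<le> 2"
proof -
  obtain c v where z: "z = (c, v)" by (cases z)
  have h: "histogram (samples_in d (xs @ z # ys)) i
      = histogram (samples_in d (xs @ ys)) i + (if c = d \<and> v = i then 1 else 0)" for d i
    by (simp add: samples_in_def histogram_def z)
  define H where "H d i = histogram (samples_in d (xs @ ys)) i" for d i
  define G where "G d i = histogram (samples_in d (xs @ z # ys)) i" for d i
  have GH: "G d i = H d i + (if c = d \<and> v = i then 1 else 0)" for d i
    using h by (simp add: G_def H_def)
  let ?t = "\<lambda>X i. \<bar>X 1 i - X 3 i\<bar> + \<bar>X 2 i - X 4 i\<bar> - \<bar>X 1 i - X 2 i\<bar> - \<bar>X 3 i - (X 4 i :: int)\<bar>"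
  have diff: "labelled_statistic n (xs @ z # ys) - labelled_statistic n (xs @ ys)
      = (\<Sum>i = 1..n. ?t G i - ?t H i)"
    unfolding labelled_statistic_def test_statistic_def G_def H_def by (rule sum_subtractf[symmetric])
  have "\<bar>labelled_statistic n (xs @ z # ys) - labelled_statistic n (xs @ ys)\<bar>
      \<le> (\<Sum>i = 1..n. \<bar>?t G i - ?t H i\<bar>)" unfolding diff by (rule sum_abs)
  also have "\<dots> \<le> (\<Sum>i = 1..n. if v = i then 2 else 0)"
  proof (rule sum_mono)
    fix i
    define e where "e d = (if c = d \<and> v = i then 1 else 0 :: int)" for d
    define D where "D a b = \<bar>G a i - G b i\<bar> - \<bar>H a i - H b i\<bar>" for a b
    have D: "\<bar>D a b\<bar> \<le> e a + e b" for a b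
    proof -
      have "\<bar>D a b\<bar> \<le> \<bar>(G a i - G b i) - (H a i - H b i)\<bar>"
        unfolding D_def by (rule abs_triangle_ineq3)
      also have "(G a i - G b i) - (H a i - H b i) = e a - e b" unfolding GH e_def by simp
      also have "\<bar>e a - e b\<bar> \<le> e a + e b" unfolding e_def by simp
      finally show ?thesis .
    qed
    have "(a + b - c - d) - (a' + b' - c' - d') = (a - a') + (b - b') - (c - c') - (d - d')"
      for a b c d a' b' c' d' :: int by simp
    then have eq: "?t G i - ?t H i = D 1 3 + D 2 4 - D 1 2 - D 3 4" unfolding D_def .
    have "\<bar>?t G i - ?t H i\<bar> \<le> 2 * (e 1 + e 2 + e 3 + e 4)"
    proof -
      have "\<bar>d1 + d2 - d3 - d4\<bar> \<le> 2 * (e1 + e2 + e3 + e4)"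
        if "\<bar>d1\<bar> \<le> e1 + e3" "\<bar>d2\<bar> \<le> e2 + e4" "\<bar>d3\<bar> \<le> e1 + e2" "\<bar>d4\<bar> \<le> e3 + e4"
        for d1 d2 d3 d4 e1 e2 e3 e4 :: int
        using that by (smt (verit))
      from this[OF D D D D] show ?thesis unfolding eq .
    qed
    also have "\<dots> \<le> (if v = i then 2 else 0)" by (simp add: e_def)
    finally show "\<bar>?t G i - ?t H i\<bar> \<le> (if v = i then 2 else 0)" .
  qed
  also have "\<dots> \<le> 2" by simp
  finally show ?thesis .
qed

lemma labelled_statistic_bounded_differences:
  "\<bar>real_of_int (labelled_statistic n (xs @ x # ys)) - real_of_int (labelled_statistic n (xs @ y # ys))\<bar> \<le> 4"
proof -
  have "\<bar>labelled_statistic n (xs @ x # ys) - labelled_statistic n (xs @ y # ys)\<bar> \<le> 4"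
    using labelled_statistic_insert[of n xs x ys] labelled_statistic_insert[of n xs y ys] by linarith
  then show ?thesis by linarith
qed

section \<open>Binomial counts and the joint law of two sample sizes\<close>

lemma map_pmf_eq_bernoulli: "map_pmf (\<lambda>x. x = i) p = bernoulli_pmf (pmf p i)"
proof (rule pmf_eqI)
  fix b
  have T: "pmf (map_pmf (\<lambda>x. x = i) p) True = pmf p i"
    by (simp add: pmf_map vimage_def measure_pmf_single)
  have "pmf (map_pmf (\<lambda>x. x = i) p) False = 1 - pmf (map_pmf (\<lambda>x. x = i) p) True"
    by (simp add: pmf_False_conv_True)
  with T show "pmf (map_pmf (\<lambda>x. x = i) p) b = pmf (bernoulli_pmf (pmf p i)) b"
    by (cases b) (simp_all add: pmf_le_1)
qed

lemma count_sample_multiset: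
  "map_pmf (\<lambda>M. count M i) (sample_multiset m p) = binomial_pmf m (pmf p i)"
proof (induction m)
  case 0
  show ?case by (simp add: sample_multiset_0 binomial_pmf_0 pmf_le_1)
next
  case (Suc m)
  have "binomial_pmf (Suc m) (pmf p i) = bernoulli_pmf (pmf p i) \<bind>
      (\<lambda>b. binomial_pmf m (pmf p i) \<bind> (\<lambda>j. return_pmf ((if b then 1 else 0) + j)))"
    by (rule binomial_pmf_Suc) (simp add: pmf_le_1)
  also have "\<dots> = p \<bind> (\<lambda>x. sample_multiset m p \<bind> (\<lambda>M. return_pmf ((if x = i then 1 else 0) + count M i)))"
    unfolding Suc.IH[symmetric] map_pmf_eq_bernoulli[symmetric] bind_map_pmf ..
  also have "\<dots> = map_pmf (\<lambda>M. count M i) (sample_multiset (Suc m) p)"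
    unfolding sample_multiset_Suc
    by (subst bind_commute_pmf) (auto simp: map_pmf_def bind_assoc_pmf bind_return_pmf intro!: bind_pmf_cong)
  finally show ?case by simp
qed

lemma expectation_count_le:
  "measure_pmf.expectation (sample_multiset m p) (\<lambda>M. of_bool (count M i \<le> x)) = binomial_cdf m (pmf p i) x"
proof -
  have "measure_pmf.expectation (sample_multiset m p) (\<lambda>M. of_bool (count M i \<le> x))
      = measure_pmf.expectation (binomial_pmf m (pmf p i)) (\<lambda>j. of_bool (j \<le> x) :: real)"
    unfolding count_sample_multiset[symmetric] by simp
  also have "\<dots> = (\<Sum>j\<le>m. Bernstein m j (pmf p i) * of_bool (j \<le> x))"
    by (subst expectation_binomial_pmf') (auto simp: pmf_le_1 Bernstein_def)
  also have "\<dots> = (\<Sum>j\<le>m. if j \<in> {..x} then Bernstein m j (pmf p i) else 0)"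
    by (intro sum.cong) auto
  also have "\<dots> = (\<Sum>j\<in>{..m} \<inter> {..x}. Bernstein m j (pmf p i))"
    by (rule sum.inter_restrict[symmetric]) simp
  \<comment> \<open>If \<open>x > m\<close>, the additional terms vanish because the binomial
    coefficient does.\<close>
  also have "\<dots> = (\<Sum>j\<le>x. Bernstein m j (pmf p i))"
    by (rule sum.mono_neutral_left) (auto simp: Bernstein_def)
  finally show ?thesis by (simp add: binomial_cdf_def)
qed

text \<open>The probabilistic counterpart of \<open>trinomial_prob_Suc\<close>: label
  \<open>a\<close> or \<open>b\<close> shifts one coordinate injectively, and the two remaining
  labels leave the pair unchanged.\<close>

lemma pmf_pair_count_step:
  fixes L :: "(nat \<times> nat) pmf"
  defines "f \<equiv> \<lambda>a b (c::nat) z. (if c = a then Suc (fst z) else fst z, if c = b then Suc (snd z) else snd z)"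
  assumes ab: "a \<in> {1..4}" "b \<in> {1..4}" "a \<noteq> b"
  shows "pmf (pmf_of_set {1..4} \<bind> (\<lambda>c. map_pmf (f a b c) L)) (i, j)
       = (if i = 0 then 0 else pmf L (i - 1, j)) / 4 + (if j = 0 then 0 else pmf L (i, j - 1)) / 4
         + pmf L (i, j) / 2"
proof -
  define g where "g c = pmf (map_pmf (f a b c) L) (i, j)" for c
  have total: "pmf (pmf_of_set {1..4} \<bind> (\<lambda>c. map_pmf (f a b c) L)) (i, j) = (\<Sum>c\<in>{1..4}. g c) / 4"
    by (simp add: pmf_bind integral_pmf_of_set g_def)
  have split: "(\<Sum>c\<in>{1..4}. g c) = (\<Sum>c\<in>{1..4} - {a, b}. g c) + (g a + g b)"
    using ab sum.subset_diff[of "{a, b}" "{1..4}" g] by simp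
  have "g c = pmf L (i, j)" if "c \<in> {1..4} - {a, b}" for c
  proof -
    have "f a b c = id" using that by (simp add: fun_eq_iff f_def)
    then show ?thesis by (simp add: g_def pmf.map_id)
  qed
  then have rest: "(\<Sum>c\<in>{1..4} - {a, b}. g c) = 2 * pmf L (i, j)"
    using ab by (simp add: card_Diff_subset)
  have inj: "inj (f a b a)" "inj (f a b b)" using ab by (simp_all add: inj_def f_def prod_eq_iff)
  have ga: "g a = (if i = 0 then 0 else pmf L (i - 1, j))"
  proof (cases i)
    case 0
    have "(0, j) \<notin> set_pmf (map_pmf (f a b a) L)" by (auto simp: f_def)
    with 0 show ?thesis by (simp add: g_def pmf_eq_0_set_pmf)
  next
    case (Suc i')
    have "f a b a (i', j) = (i, j)" using ab Suc by (simp add: f_def)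
    then show ?thesis using pmf_map_inj'[OF inj(1), of L "(i', j)"] Suc by (simp add: g_def)
  qed
  have gb: "g b = (if j = 0 then 0 else pmf L (i, j - 1))"
  proof (cases j)
    case 0
    have "(i, 0) \<notin> set_pmf (map_pmf (f a b b) L)" by (auto simp: f_def)
    with 0 show ?thesis by (simp add: g_def pmf_eq_0_set_pmf)
  next
    case (Suc j')
    have "f a b b (i, j') = (i, j)" using ab Suc by (simp add: f_def)
    then show ?thesis using pmf_map_inj'[OF inj(2), of L "(i, j')"] Suc by (simp add: g_def)
  qed
  show ?thesis unfolding total split rest ga gb by simp
qed

lemma pmf_multinomial_pair:
  assumes ab: "a \<in> {1..4}" "b \<in> {1..4}" "a \<noteq> b"
  shows "pmf (map_pmf (\<lambda>m. (m a, m b)) (multinomial_pmf N (pmf_of_set {1..4::nat}))) (i, j)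
       = trinomial_prob N i j"
proof (induction N arbitrary: i j)
  case 0
  show ?case by (auto simp: multinomial_pmf_0 trinomial_prob_0 indicator_def)
next
  case (Suc N)
  have "map_pmf (\<lambda>m. (m a, m b)) (multinomial_pmf (Suc N) (pmf_of_set {1..4::nat}))
      = pmf_of_set {1..4} \<bind> (\<lambda>c. map_pmf (\<lambda>z. (if c = a then Suc (fst z) else fst z,
          if c = b then Suc (snd z) else snd z)) (map_pmf (\<lambda>m. (m a, m b)) (multinomial_pmf N (pmf_of_set {1..4}))))"
    unfolding multinomial_pmf_Suc map_bind_pmf
    by (intro bind_pmf_cong refl) (auto simp: map_pmf_def bind_assoc_pmf bind_return_pmf intro!: bind_pmf_cong)
  then show ?case
    by (simp only: pmf_pair_count_step[OF ab] Suc.IH trinomial_prob_Suc)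
qed

section \<open>The mean of the statistic\<close>

lemma expectation_cong_pmf:
  "(\<And>x. x \<in> set_pmf p \<Longrightarrow> f x = g x) \<Longrightarrow>
     measure_pmf.expectation p f = measure_pmf.expectation p (g :: _ \<Rightarrow> real)"
  by (intro integral_cong_AE) (auto simp: AE_measure_pmf_iff)

lemma expectation_ge_sum:
  fixes f :: "'a \<Rightarrow> real"
  assumes "finite (set_pmf p)" "finite B" "\<And>x. 0 \<le> f x"
  shows "(\<Sum>x\<in>B. pmf p x * f x) \<le> measure_pmf.expectation p f"
proof -
  have "(\<Sum>x\<in>B. pmf p x * f x) \<le> (\<Sum>x\<in>set_pmf p \<union> B. pmf p x * f x)"
    using assms by (intro sum_mono2) auto
  also have "\<dots> = measure_pmf.expectation p f"
    using assms by (subst integral_measure_pmf[of "set_pmf p \<union> B"]) auto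
  finally show ?thesis .
qed

lemma expectation_four_samples_product:
  fixes f1 f2 f3 f4 :: "'a multiset \<Rightarrow> real"
  assumes "finite (set_pmf p)" "finite (set_pmf q)"
  shows "measure_pmf.expectation (four_samples_pmf m p q) (\<lambda>(S, S', T, T'). f1 S * f2 S' * f3 T * f4 T')
       = measure_pmf.expectation (sample_multiset (m 1) p) f1
       * measure_pmf.expectation (sample_multiset (m 2) p) f2
       * measure_pmf.expectation (sample_multiset (m 3) q) f3
       * measure_pmf.expectation (sample_multiset (m 4) q) f4"
  using assms by (simp add: four_samples_pmf_def expectation_bind_pmf_finite mult.assoc)

lemma finite_set_four_samples_pmf [simp]:
  "finite (set_pmf p) \<Longrightarrow> finite (set_pmf q) \<Longrightarrow> finite (set_pmf (four_samples_pmf m p q))"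
  by (simp add: four_samples_pmf_def)

text \<open>The summand is \<open>1\<close> exactly when the threshold \<open>x\<close> separates
  the two numbers, that is, when it is at least the smaller and below the larger one.\<close>

lemma abs_diff_eq_sum_of_bool:
  assumes "a \<le> K" "b \<le> K"
  shows "\<bar>real a - real b\<bar> = (\<Sum>x<K. of_bool (a \<le> x) + of_bool (b \<le> x) - 2 * (of_bool (a \<le> x) * of_bool (b \<le> x)))"
  using assms
proof (induction a b rule: linorder_wlog)
  case (le a b)
  have "(\<Sum>x<K. of_bool (a \<le> x) + of_bool (b \<le> x) - 2 * (of_bool (a \<le> x) * of_bool (b \<le> x)))
      = (\<Sum>x<K. if x \<in> {a..<b} then 1 else 0 :: real)"
    using le by (intro sum.cong) auto
  also have "\<dots> = (\<Sum>x\<in>{..<K} \<inter> {a..<b}. 1)" by (rule sum.inter_restrict[symmetric]) simp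
  also have "{..<K} \<inter> {a..<b} = {a..<b}" using le by auto
  finally show ?case using le by simp
next
  case (sym a b)
  then show ?case by (simp add: abs_minus_commute add.commute mult.commute)
qed

text \<open>Each of the four numbers occurs in one absolute value with sign plus and one with sign
  minus, so only products of indicators survive.\<close>

lemma four_point_eq_sum_of_bool:
  assumes "a \<le> K" "a' \<le> K" "b \<le> K" "b' \<le> K"
  shows "\<bar>real a - real b\<bar> + \<bar>real a' - real b'\<bar> - \<bar>real a - real a'\<bar> - \<bar>real b - real b'\<bar>
    = (\<Sum>x<K. 2 * (of_bool (a \<le> x) * of_bool (a' \<le> x) + of_bool (b \<le> x) * of_bool (b' \<le> x)
        - of_bool (a \<le> x) * of_bool (b \<le> x) - of_bool (a' \<le> x) * of_bool (b' \<le> x)))"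
  unfolding abs_diff_eq_sum_of_bool[OF assms(1,3)] abs_diff_eq_sum_of_bool[OF assms(2,4)]
    abs_diff_eq_sum_of_bool[OF assms(1,2)] abs_diff_eq_sum_of_bool[OF assms(3,4)]
    sum.distrib[symmetric] sum_subtractf[symmetric]
  by (intro sum.cong) auto

lemma expectation_four_point:
  fixes p q :: "'a pmf"
  assumes fin: "finite (set_pmf p)" "finite (set_pmf q)"
    and mK: "m 1 \<le> K" "m 2 \<le> K" "m 3 \<le> K" "m 4 \<le> K"
  shows "measure_pmf.expectation (four_samples_pmf m p q) (\<lambda>(S, S', T, T').
       \<bar>real (count S i) - real (count T i)\<bar> + \<bar>real (count S' i) - real (count T' i)\<bar>
       - \<bar>real (count S i) - real (count S' i)\<bar> - \<bar>real (count T i) - real (count T' i)\<bar>)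
     = (\<Sum>x<K. 2 * (binomial_cdf (m 1) (pmf p i) x * binomial_cdf (m 2) (pmf p i) x
          + binomial_cdf (m 3) (pmf q i) x * binomial_cdf (m 4) (pmf q i) x
          - binomial_cdf (m 1) (pmf p i) x * binomial_cdf (m 3) (pmf q i) x
          - binomial_cdf (m 2) (pmf p i) x * binomial_cdf (m 4) (pmf q i) x))"
    (is "measure_pmf.expectation ?M ?W = _")
proof -
  define u where "u x M = (of_bool (count M i \<le> x) :: real)" for x and M :: "'a multiset"
  define V where "V x = (\<lambda>(S, S', T, T'). u x S * u x S' + u x T * u x T' - u x S * u x T - u x S' * u x T')" for x
  have int: "integrable ?M h" for h :: "_ \<Rightarrow> real"
    using fin by (intro integrable_measure_pmf_finite) auto
  have EV: "measure_pmf.expectation ?M (V x) = binomial_cdf (m 1) (pmf p i) x * binomial_cdf (m 2) (pmf p i) x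
          + binomial_cdf (m 3) (pmf q i) x * binomial_cdf (m 4) (pmf q i) x
          - binomial_cdf (m 1) (pmf p i) x * binomial_cdf (m 3) (pmf q i) x
          - binomial_cdf (m 2) (pmf p i) x * binomial_cdf (m 4) (pmf q i) x" for x
  proof -
    note E = expectation_four_samples_product[OF fin, of m]
    have Eu: "measure_pmf.expectation (sample_multiset j r) (u x) = binomial_cdf j (pmf r i) x" for j and r :: "'a pmf"
      unfolding u_def by (rule expectation_count_le)
    \<comment> \<open>Constant factors \<open>1\<close> bring every product into the shape of
      \<open>expectation_four_samples_product\<close>.\<close>
    have V: "V x = (\<lambda>z. (case z of (S, S', T, T') \<Rightarrow> u x S * u x S' * 1 * 1)
        + (case z of (S, S', T, T') \<Rightarrow> 1 * 1 * u x T * u x T')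
        - (case z of (S, S', T, T') \<Rightarrow> u x S * 1 * u x T * 1)
        - (case z of (S, S', T, T') \<Rightarrow> 1 * u x S' * 1 * u x T'))"
      by (auto simp: V_def)
    show ?thesis
      unfolding V Bochner_Integration.integral_diff[OF int int] Bochner_Integration.integral_add[OF int int]
        E[of "u x" "u x" "\<lambda>_. 1" "\<lambda>_. 1"] E[of "\<lambda>_. 1" "\<lambda>_. 1" "u x" "u x"]
        E[of "u x" "\<lambda>_. 1" "u x" "\<lambda>_. 1"] E[of "\<lambda>_. 1" "u x" "\<lambda>_. 1" "u x"] Eu by simp
  qed
  have "?W z = (\<Sum>x<K. 2 * V x z)" if "z \<in> set_pmf ?M" for z
  proof -
    obtain S S' T T' where z: "z = (S, S', T, T')" by (cases z)
    have "size S = m 1" "size S' = m 2" "size T = m 3" "size T' = m 4"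
      using that by (auto simp: z four_samples_pmf_def dest: size_sample_multiset)
    then have "count S i \<le> K" "count S' i \<le> K" "count T i \<le> K" "count T' i \<le> K"
      using mK count_le_size[of S i] count_le_size[of S' i] count_le_size[of T i] count_le_size[of T' i] by auto
    from four_point_eq_sum_of_bool[OF this] show ?thesis by (simp add: z V_def u_def)
  qed
  then have "measure_pmf.expectation ?M ?W = measure_pmf.expectation ?M (\<lambda>z. \<Sum>x<K. 2 * V x z)"
    by (rule expectation_cong_pmf)
  also have "\<dots> = (\<Sum>x<K. 2 * measure_pmf.expectation ?M (V x))"
    using int by (simp add: Bochner_Integration.integral_sum)
  finally show ?thesis unfolding EV .
qed

lemma expectation_multinomial_pair:
  fixes \<phi> :: "nat \<Rightarrow> nat \<Rightarrow> real"
  assumes "a \<in> {1..4}" "b \<in> {1..4}" "a \<noteq> b"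
  shows "measure_pmf.expectation (multinomial_pmf N (pmf_of_set {1..4::nat})) (\<lambda>m. \<phi> (m a) (m b))
       = measure_pmf.expectation (multinomial_pmf N (pmf_of_set {1..4::nat})) (\<lambda>m. \<phi> (m 1) (m 2))"
proof -
  let ?w = "pmf_of_set {1..4::nat}"
  have 12: "1 \<in> {1..4::nat}" "2 \<in> {1..4::nat}" "(1::nat) \<noteq> 2" by auto
  have "map_pmf (\<lambda>m. (m a, m b)) (multinomial_pmf N ?w) = map_pmf (\<lambda>m. (m 1, m 2)) (multinomial_pmf N ?w)"
  proof (rule pmf_eqI)
    fix z :: "nat \<times> nat"
    obtain i j where "z = (i, j)" by (cases z)
    then show "pmf (map_pmf (\<lambda>m. (m a, m b)) (multinomial_pmf N ?w)) z
        = pmf (map_pmf (\<lambda>m. (m 1, m 2)) (multinomial_pmf N ?w)) z"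
      by (simp only: pmf_multinomial_pair[OF assms] pmf_multinomial_pair[OF 12])
  qed
  then have "measure_pmf.expectation (map_pmf (\<lambda>m. (m a, m b)) (multinomial_pmf N ?w)) (case_prod \<phi>)
      = measure_pmf.expectation (map_pmf (\<lambda>m. (m 1, m 2)) (multinomial_pmf N ?w)) (case_prod \<phi>)" by simp
  then show ?thesis by simp
qed

text \<open>
  The terms linear in the distribution functions cancel, and exchangeability of the four sample
  sizes turns the remaining products into the product of two differences of the same sign.
\<close>

lemma expectation_labelled_statistic:
  fixes p q :: "nat pmf"
  assumes fin: "finite (set_pmf p)" "finite (set_pmf q)"
  defines "A \<equiv> \<lambda>i m x. binomial_cdf m (pmf p i) x - binomial_cdf m (pmf q i) x"
  shows "measure_pmf.expectation (replicate_pmf N (labelled_sample_pmf p q)) (\<lambda>l. real_of_int (labelled_statistic n l))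
     = (\<Sum>i=1..n. \<Sum>x<N. 2 * measure_pmf.expectation (multinomial_pmf N (pmf_of_set {1..4::nat}))
           (\<lambda>m. A i (m 1) x * A i (m 2) x))"
proof -
  let ?mult = "multinomial_pmf N (pmf_of_set {1..4::nat})"
  define W where "W i = (\<lambda>(S, S', T, T'). \<bar>real (count S i) - real (count T i)\<bar>
      + \<bar>real (count S' i) - real (count T' i)\<bar>
      - \<bar>real (count S i) - real (count S' i)\<bar> - \<bar>real (count T i) - real (count T' i)\<bar>)" for i :: nat
  define F where "F i m x = binomial_cdf m (pmf p i) x" for i m x
  define G where "G i m x = binomial_cdf m (pmf q i) x" for i m x
  have int: "integrable ?mult h" for h :: "_ \<Rightarrow> real"
    by (intro integrable_measure_pmf_finite) auto
  have int': "integrable (four_samples_pmf m p q) h" for m and h :: "_ \<Rightarrow> real"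
    using fin by (intro integrable_measure_pmf_finite) auto
  have "measure_pmf.expectation (replicate_pmf N (labelled_sample_pmf p q)) (\<lambda>l. real_of_int (labelled_statistic n l))
      = measure_pmf.expectation (map_pmf four_samples (replicate_pmf N (labelled_sample_pmf p q)))
          (\<lambda>z. \<Sum>i=1..n. W i z)"
    by (simp add: four_samples_def W_def labelled_statistic_def test_statistic_def histogram_def)
  also have "\<dots> = measure_pmf.expectation ?mult
      (\<lambda>m. measure_pmf.expectation (four_samples_pmf m p q) (\<lambda>z. \<Sum>i=1..n. W i z))"
    unfolding four_samples_pmf_multinomial[symmetric] using fin
    by (intro expectation_bind_pmf_finite) auto
  also have "\<dots> = measure_pmf.expectation ?mult (\<lambda>m. \<Sum>i=1..n. \<Sum>x<N. 2 * (F i (m 1) x * F i (m 2) x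
      + G i (m 3) x * G i (m 4) x - F i (m 1) x * G i (m 3) x - F i (m 2) x * G i (m 4) x))"
  proof (rule expectation_cong_pmf)
    fix m assume m: "m \<in> set_pmf ?mult"
    have "measure_pmf.expectation (four_samples_pmf m p q) (\<lambda>z. \<Sum>i=1..n. W i z)
        = (\<Sum>i=1..n. measure_pmf.expectation (four_samples_pmf m p q) (W i))"
      using int' by (rule Bochner_Integration.integral_sum)
    also have "\<dots> = (\<Sum>i=1..n. \<Sum>x<N. 2 * (F i (m 1) x * F i (m 2) x
      + G i (m 3) x * G i (m 4) x - F i (m 1) x * G i (m 3) x - F i (m 2) x * G i (m 4) x))"
      unfolding W_def F_def G_def
      by (intro sum.cong refl expectation_four_point fin multinomial_pmf_le[OF m])
    finally show "measure_pmf.expectation (four_samples_pmf m p q) (\<lambda>z. \<Sum>i=1..n. W i z) = \<dots>" .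
  qed
  also have "\<dots> = (\<Sum>i=1..n. \<Sum>x<N. 2 * measure_pmf.expectation ?mult (\<lambda>m. F i (m 1) x * F i (m 2) x
      + G i (m 3) x * G i (m 4) x - F i (m 1) x * G i (m 3) x - F i (m 2) x * G i (m 4) x))"
    using int by (simp add: Bochner_Integration.integral_sum)
  also have "\<dots> = (\<Sum>i=1..n. \<Sum>x<N. 2 * measure_pmf.expectation ?mult (\<lambda>m. A i (m 1) x * A i (m 2) x))"
  proof (intro sum.cong refl arg_cong[where f = "(*) 2"])
    fix i x
    note X = expectation_multinomial_pair[where N = N]
    have 1: "measure_pmf.expectation ?mult (\<lambda>m. G i (m 3) x * G i (m 4) x)
        = measure_pmf.expectation ?mult (\<lambda>m. G i (m 1) x * G i (m 2) x)"
      using X[of 3 4 "\<lambda>a b. G i a x * G i b x"] by simp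
    have 2: "measure_pmf.expectation ?mult (\<lambda>m. F i (m 1) x * G i (m 3) x)
        = measure_pmf.expectation ?mult (\<lambda>m. F i (m 1) x * G i (m 2) x)"
      using X[of 1 3 "\<lambda>a b. F i a x * G i b x"] by simp
    \<comment> \<open>The reversed pair \<open>4, 2\<close> sends \<open>m 4\<close> to
      \<open>m 1\<close> and keeps \<open>m 2\<close>, which yields the second mixed term of the
      expanded product of differences.\<close>
    have 3: "measure_pmf.expectation ?mult (\<lambda>m. F i (m 2) x * G i (m 4) x)
        = measure_pmf.expectation ?mult (\<lambda>m. F i (m 2) x * G i (m 1) x)"
      using X[of 4 2 "\<lambda>a b. F i b x * G i a x"] by simp
    have "measure_pmf.expectation ?mult (\<lambda>m. F i (m 1) x * F i (m 2) x
        + G i (m 3) x * G i (m 4) x - F i (m 1) x * G i (m 3) x - F i (m 2) x * G i (m 4) x)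
      = measure_pmf.expectation ?mult (\<lambda>m. F i (m 1) x * F i (m 2) x
        + G i (m 1) x * G i (m 2) x - F i (m 1) x * G i (m 2) x - F i (m 2) x * G i (m 1) x)"
      unfolding Bochner_Integration.integral_diff[OF int int] Bochner_Integration.integral_add[OF int int] 1 2 3 ..
    also have "\<dots> = measure_pmf.expectation ?mult (\<lambda>m. A i (m 1) x * A i (m 2) x)"
      by (simp add: A_def F_def G_def algebra_simps)
    finally show "measure_pmf.expectation ?mult (\<lambda>m. F i (m 1) x * F i (m 2) x
        + G i (m 3) x * G i (m 4) x - F i (m 1) x * G i (m 3) x - F i (m 2) x * G i (m 4) x) = \<dots>" .
  qed
  finally show ?thesis .
qed

section \<open>Lower bound for the mean when the distributions differ\<close>

text \<open>Nonnegativity permits discarding all pairs outside the square. Inside it the joint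
  probability is bounded below by a constant, and the sum of products over the square is a perfect
  square.\<close>

lemma expectation_multinomial_product_ge:
  fixes A :: "nat \<Rightarrow> real"
  assumes k: "k \<ge> 1" "16 * t\<^sup>2 \<le> k" "k \<le> 16 * (t + 1)\<^sup>2" and A: "\<And>m m'. 0 \<le> A m * A m'"
  shows "(\<Sum>m=k-t..k. A m)\<^sup>2 / (128 * (real t + 1)\<^sup>2)
      \<le> measure_pmf.expectation (multinomial_pmf (4 * k) (pmf_of_set {1..4::nat})) (\<lambda>m. A (m 1) * A (m 2))"
proof -
  let ?L = "map_pmf (\<lambda>m. (m 1, m 2)) (multinomial_pmf (4 * k) (pmf_of_set {1..4::nat}))" and ?I = "{k-t..k}"
  have "(\<Sum>m\<in>?I. A m)\<^sup>2 / (128 * (real t + 1)\<^sup>2)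
      = (\<Sum>a\<in>?I. \<Sum>b\<in>?I. 1 / (128 * (real t + 1)\<^sup>2) * (A a * A b))"
    by (simp add: power2_eq_square sum_product sum_divide_distrib)
  also have "\<dots> = (\<Sum>z\<in>?I \<times> ?I. 1 / (128 * (real t + 1)\<^sup>2) * (A (fst z) * A (snd z)))"
    by (simp add: sum.cartesian_product case_prod_beta)
  also have "\<dots> \<le> (\<Sum>z\<in>?I \<times> ?I. pmf ?L z * (A (fst z) * A (snd z)))"
  proof (intro sum_mono mult_right_mono A)
    fix z assume z: "z \<in> ?I \<times> ?I"
    then obtain a b where ab: "z = (a, b)" "a \<in> ?I" "b \<in> ?I" by blast
    have 12: "1 \<in> {1..4::nat}" "2 \<in> {1..4::nat}" "(1::nat) \<noteq> 2" by auto
    show "1 / (128 * (real t + 1)\<^sup>2) \<le> pmf ?L z"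
      unfolding ab(1) pmf_multinomial_pair[OF 12] by (rule trinomial_prob_near_center_ge[OF k ab(2,3)])
  qed
  also have "\<dots> \<le> measure_pmf.expectation ?L (\<lambda>z. A (fst z) * A (snd z))"
    by (rule expectation_ge_sum) (use A in auto)
  also have "\<dots> = measure_pmf.expectation (multinomial_pmf (4 * k) (pmf_of_set {1..4::nat})) (\<lambda>m. A (m 1) * A (m 2))"
    by simp
  finally show ?thesis .
qed

lemma expectation_four_point_ge:
  fixes P Q :: real
  assumes k: "k \<ge> 1" and PQ: "0 \<le> P" "P \<le> 1" "0 \<le> Q" "Q \<le> 1"
  defines "A \<equiv> \<lambda>m x. binomial_cdf m P x - binomial_cdf m Q x"
  shows "(real k * \<bar>P - Q\<bar>)\<^sup>2 / (2048 * (1 + sqrt (real k * max P Q) + real k * \<bar>P - Q\<bar>))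
    \<le> (\<Sum>x<4*k. 2 * measure_pmf.expectation (multinomial_pmf (4 * k) (pmf_of_set {1..4::nat}))
           (\<lambda>m. A (m 1) x * A (m 2) x))"
proof -
  \<comment> \<open>Exchanging \<open>P\<close> and \<open>Q\<close> flips the sign of both factors,
    so products are unaffected and the success probabilities may be taken in increasing
    order.\<close>
  define B where "B m x = binomial_cdf m (min P Q) x - binomial_cdf m (max P Q) x" for m x
  have AB: "A m x * A m' x = B m x * B m' x" for m m' x
    by (auto simp: A_def B_def min_def max_def algebra_simps)
  have B0: "0 \<le> B m x * B m' x" for m m' x
    unfolding B_def using PQ by (intro mult_nonneg_nonneg) (auto intro!: binomial_cdf_antimono)
  \<comment> \<open>The integer part of \<open>sqrt k / 4\<close> gives both
    \<open>16 * t\<^sup>2 <= k\<close> and \<open>k <= 16 * (t + 1)\<^sup>2\<close>.\<close>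
  define t where "t = nat \<lfloor>sqrt (real k) / 4\<rfloor>"
  have t1: "real t \<le> sqrt (real k) / 4" unfolding t_def by (intro of_nat_floor) simp
  have t2: "sqrt (real k) / 4 \<le> real t + 1" unfolding t_def by linarith
  have "(4 * real t)\<^sup>2 \<le> (sqrt (real k))\<^sup>2" using t1 by (intro power_mono) auto
  then have "real (16 * t\<^sup>2) \<le> real k" by (simp add: power_mult_distrib)
  then have kt1: "16 * t\<^sup>2 \<le> k" by (simp only: of_nat_le_iff)
  have "(sqrt (real k))\<^sup>2 \<le> (4 * (real t + 1))\<^sup>2" using t2 by (intro power_mono) auto
  then have "(sqrt (real k))\<^sup>2 \<le> 4\<^sup>2 * (real t + 1)\<^sup>2" by (simp only: power_mult_distrib)
  then have "real k \<le> 16 * (real t + 1)\<^sup>2" by simp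
  also have "\<dots> = real (16 * (t + 1)\<^sup>2)" by (simp add: add.commute)
  finally have kt2: "k \<le> 16 * (t + 1)\<^sup>2" by (simp only: of_nat_le_iff)
  define w where "w = 1 + sqrt (real k * max P Q) + real k * \<bar>P - Q\<bar>"
  have PQ': "max P Q - min P Q = \<bar>P - Q\<bar>" by auto
  have "(real t + 1)\<^sup>2 * (real k * \<bar>P - Q\<bar>)\<^sup>2 / (32 * w)
      \<le> (\<Sum>x<4*k. (\<Sum>m=k-t..k. B m x)\<^sup>2)"
    using sum_square_averaged_cdf_diff_ge[OF k kt1, of "4 * k" "min P Q" "max P Q"] PQ
    unfolding B_def w_def PQ' by simp
  \<comment> \<open>The divisor contains \<open>64 = 128 / 2\<close>, which absorbs the factor
    \<open>2\<close> in front of the expectation. Together with \<open>32\<close> this gives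
    \<open>2048\<close>.\<close>
  then have "(real t + 1)\<^sup>2 * (real k * \<bar>P - Q\<bar>)\<^sup>2 / (32 * w) / (64 * (real t + 1)\<^sup>2)
      \<le> (\<Sum>x<4*k. (\<Sum>m=k-t..k. B m x)\<^sup>2) / (64 * (real t + 1)\<^sup>2)"
    by (intro divide_right_mono) auto
  also have "\<dots> = (\<Sum>x<4*k. 2 * ((\<Sum>m=k-t..k. B m x)\<^sup>2 / (128 * (real t + 1)\<^sup>2)))"
    unfolding sum_divide_distrib by (intro sum.cong refl) simp
  also have "\<dots> \<le> (\<Sum>x<4*k. 2 * measure_pmf.expectation (multinomial_pmf (4 * k) (pmf_of_set {1..4::nat}))
           (\<lambda>m. A (m 1) x * A (m 2) x))"
    unfolding AB by (intro sum_mono mult_left_mono expectation_multinomial_product_ge k kt1 kt2 B0) simp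
  also have "(real t + 1)\<^sup>2 * (real k * \<bar>P - Q\<bar>)\<^sup>2 / (32 * w) / (64 * (real t + 1)\<^sup>2)
      = (real k * \<bar>P - Q\<bar>)\<^sup>2 / (2048 * w)"
  proof -
    have "real t + 1 \<noteq> 0" by linarith
    then show ?thesis by simp
  qed
  finally show ?thesis by (simp add: w_def)
qed

text \<open>Cauchy--Schwarz in weighted form, after splitting \<open>a i\<close> as
  \<open>a i / sqrt (w i)\<close> times \<open>sqrt (w i)\<close>.\<close>

lemma sum_power2_divide_ge:
  fixes a w :: "'i \<Rightarrow> real"
  assumes "\<And>i. i \<in> I \<Longrightarrow> 0 < w i"
  shows "(\<Sum>i\<in>I. a i)\<^sup>2 \<le> (\<Sum>i\<in>I. (a i)\<^sup>2 / w i) * (\<Sum>i\<in>I. w i)"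
proof -
  have "a i = a i / sqrt (w i) * sqrt (w i)" if "i \<in> I" for i using assms[OF that] by simp
  then have "(\<Sum>i\<in>I. a i)\<^sup>2 = (\<Sum>i\<in>I. a i / sqrt (w i) * sqrt (w i))\<^sup>2"
    by (intro arg_cong[where f = "\<lambda>x. x\<^sup>2"] sum.cong refl)
  also have "\<dots> \<le> (\<Sum>i\<in>I. (a i / sqrt (w i))\<^sup>2) * (\<Sum>i\<in>I. (sqrt (w i))\<^sup>2)"
    by (rule Cauchy_Schwarz_ineq_sum)
  also have "(\<Sum>i\<in>I. (a i / sqrt (w i))\<^sup>2) = (\<Sum>i\<in>I. (a i)\<^sup>2 / w i)"
    using assms by (intro sum.cong) (auto simp: power_divide less_imp_le)
  also have "(\<Sum>i\<in>I. (sqrt (w i))\<^sup>2) = (\<Sum>i\<in>I. w i)"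
    using assms by (intro sum.cong) (auto simp: less_imp_le)
  finally show ?thesis .
qed

lemma sum_pmf_le_1: "finite I \<Longrightarrow> (\<Sum>i\<in>I. pmf p i) \<le> 1"
  by (simp add: measure_measure_pmf_finite[symmetric])

text \<open>The weighted Cauchy--Schwarz inequality with the window lengths as weights. Their sum is
  bounded termwise, the square roots by a further Cauchy--Schwarz step together with
  \<open>max (pmf p i) (pmf q i) <= pmf p i + pmf q i\<close>.\<close>

lemma expectation_labelled_statistic_ge:
  fixes p q :: "nat pmf" and n k :: nat
  assumes fin: "finite (set_pmf p)" "finite (set_pmf q)" and k: "k \<ge> 1"
  defines "D \<equiv> 2 * real k * tv_dist n p q"
  shows "D\<^sup>2 \<le> 2048 * (real n + sqrt (2 * real k * real n) + D)
     * measure_pmf.expectation (replicate_pmf (4 * k) (labelled_sample_pmf p q))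
         (\<lambda>l. real_of_int (labelled_statistic n l))"
proof -
  let ?\<Delta> = "\<lambda>i. real k * \<bar>pmf p i - pmf q i\<bar>"
  let ?\<mu> = "\<lambda>i. real k * max (pmf p i) (pmf q i)"
  let ?w = "\<lambda>i. 1 + sqrt (?\<mu> i) + ?\<Delta> i"
  let ?E = "measure_pmf.expectation (replicate_pmf (4 * k) (labelled_sample_pmf p q))
         (\<lambda>l. real_of_int (labelled_statistic n l))"
  have D: "D = (\<Sum>i=1..n. ?\<Delta> i)" by (simp add: D_def tv_dist_def sum_distrib_left)
  have mu0: "0 \<le> ?\<mu> i" for i by (simp add: le_max_iff_disj)
  have w0: "0 < ?w i" for i using real_sqrt_ge_zero[OF mu0[of i]] by (intro add_pos_nonneg) auto
  have "(\<Sum>i=1..n. (?\<Delta> i)\<^sup>2 / (2048 * ?w i)) \<le> ?E"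
    unfolding expectation_labelled_statistic[OF fin]
    by (intro sum_mono expectation_four_point_ge k) (auto simp: pmf_le_1)
  moreover have "(\<Sum>i=1..n. (?\<Delta> i)\<^sup>2 / (2048 * ?w i)) = (\<Sum>i=1..n. (?\<Delta> i)\<^sup>2 / ?w i) / 2048"
    unfolding sum_divide_distrib by (intro sum.cong refl) (simp only: divide_divide_eq_left mult.commute)
  ultimately have E: "(\<Sum>i=1..n. (?\<Delta> i)\<^sup>2 / ?w i) \<le> 2048 * ?E" by linarith
  have W: "(\<Sum>i=1..n. ?w i) \<le> real n + sqrt (2 * real k * real n) + D"
  proof -
    have "(\<Sum>i=1..n. sqrt (?\<mu> i) * 1)\<^sup>2 \<le> (\<Sum>i=1..n. (sqrt (?\<mu> i))\<^sup>2) * (\<Sum>i=1..n. 1\<^sup>2)"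
      by (rule Cauchy_Schwarz_ineq_sum)
    also have "\<dots> = (\<Sum>i=1..n. ?\<mu> i) * real n" using mu0 by simp
    also have "\<dots> \<le> (2 * real k) * real n"
    proof (rule mult_right_mono)
      have "(\<Sum>i=1..n. ?\<mu> i) \<le> (\<Sum>i=1..n. real k * (pmf p i + pmf q i))"
        by (intro sum_mono mult_left_mono) auto
      also have "\<dots> = real k * ((\<Sum>i=1..n. pmf p i) + (\<Sum>i=1..n. pmf q i))"
        by (simp add: sum_distrib_left sum.distrib distrib_left)
      also have "\<dots> \<le> real k * (1 + 1)"
        by (intro mult_left_mono add_mono sum_pmf_le_1) auto
      finally show "(\<Sum>i=1..n. ?\<mu> i) \<le> 2 * real k" by simp
    qed simp
    finally have "(\<Sum>i=1..n. sqrt (?\<mu> i)) \<le> sqrt (2 * real k * real n)"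
      by (intro real_le_rsqrt) simp
    then show ?thesis unfolding D sum.distrib by simp
  qed
  have "D\<^sup>2 \<le> (\<Sum>i=1..n. (?\<Delta> i)\<^sup>2 / ?w i) * (\<Sum>i=1..n. ?w i)"
    unfolding D by (rule sum_power2_divide_ge) (rule w0)
  also have "\<dots> \<le> (2048 * ?E) * (real n + sqrt (2 * real k * real n) + D)"
  proof (rule mult_mono[OF E W])
    have "0 \<le> (\<Sum>i=1..n. (?\<Delta> i)\<^sup>2 / ?w i)" using w0 by (intro sum_nonneg divide_nonneg_pos) auto
    with E show "0 \<le> 2048 * ?E" by linarith
    show "0 \<le> (\<Sum>i=1..n. ?w i)" using w0 by (intro sum_nonneg) (auto simp: less_imp_le)
  qed
  finally show ?thesis by (simp only: mult_ac)
qed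

section \<open>Sample size and error probabilities\<close>

text \<open>Each of the three summands of the sample size handles one summand on the left, for which
  a third of \<open>D\<^sup>2\<close> suffices; \<open>73728\<close> is \<open>3 * 24576\<close>.
  The factor \<open>24576 = 2048 * 12\<close> makes the mean at least \<open>12 * s\<close>, twice
  the threshold \<open>6 * s\<close>.\<close>

lemma sample_size_imp_separation:
  fixes n k :: nat and \<epsilon> L :: real
  assumes \<epsilon>: "0 < \<epsilon>" and L: "0 < L" and k: "k \<ge> 1"
    and bound: "real k \<ge> 40000\<^sup>2 * (real n powr (2/3) * L powr (1/3) / \<epsilon> powr (4/3)
                    + (real n powr (1/2) * L powr (1/2) + L) / \<epsilon>^2)"
    and D: "2 * real k * \<epsilon> \<le> D"
  shows "24576 * sqrt (real k * L) * (real n + sqrt (2 * real k * real n) + D) \<le> D\<^sup>2"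
proof -
  define s where "s = sqrt (real k * L)"
  define T1 where "T1 = real n powr (2/3) * L powr (1/3) / \<epsilon> powr (4/3)"
  define T2 where "T2 = sqrt (real n * L) / \<epsilon>\<^sup>2"
  define T3 where "T3 = L / \<epsilon>\<^sup>2"
  have T0: "0 \<le> T1" "0 \<le> T2" "0 \<le> T3" using \<epsilon> L by (simp_all add: T1_def T2_def T3_def)
  have "real k \<ge> 40000\<^sup>2 * (T1 + (T2 + T3))"
    using bound L by (simp add: T1_def T2_def T3_def powr_half_sqrt real_sqrt_mult add_divide_distrib)
  then have kT: "40000\<^sup>2 * T1 \<le> real k" "40000\<^sup>2 * T2 \<le> real k" "40000\<^sup>2 * T3 \<le> real k"
    using T0 by auto
  have s0: "0 < s" using k L by (simp add: s_def)
  have s2: "s\<^sup>2 = real k * L" using L by (simp add: s_def)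
  have D0: "0 < D"
  proof -
    have "0 < 2 * real k * \<epsilon>" using k \<epsilon> by simp
    with D show ?thesis by linarith
  qed
  have "(2 * real k * \<epsilon>)\<^sup>2 \<le> D\<^sup>2" using D \<epsilon> by (intro power_mono) auto
  then have D2: "4 * (real k * \<epsilon>)\<^sup>2 \<le> D\<^sup>2" by (simp add: power_mult_distrib)
  \<comment> \<open>Cubing \<open>T1\<close> removes the fractional powers. A further factor
    \<open>k\<close> turns both sides into squares, of \<open>s * n\<close> and of
    \<open>(k * \<epsilon>)\<^sup>2\<close> up to constants.\<close>
  have a: "73728 * s * real n \<le> D\<^sup>2"
  proof -
    have c: "(x powr (1/3)) ^ 3 = x" "(x powr (2/3)) ^ 3 = x\<^sup>2" "(x powr (4/3)) ^ 3 = x ^ 4"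
      if "0 \<le> x" for x :: real
    proof -
      have *: "(x powr a) ^ 3 = x powr (3 * a)" for a by (simp add: power3_eq_cube powr_add[symmetric])
      show "(x powr (1/3)) ^ 3 = x" "(x powr (2/3)) ^ 3 = x\<^sup>2" "(x powr (4/3)) ^ 3 = x ^ 4"
        unfolding * using that by (simp_all add: powr_numeral)
    qed
    have T13: "T1 ^ 3 = (real n)\<^sup>2 * L / \<epsilon> ^ 4"
      using \<epsilon> L by (simp add: T1_def power_divide power_mult_distrib c)
    have "(40000\<^sup>2 * T1) ^ 3 \<le> real k ^ 3" using kT T0 by (intro power_mono) auto
    then have "(40000\<^sup>2) ^ 3 * ((real n)\<^sup>2 * L / \<epsilon> ^ 4) \<le> real k ^ 3"
      unfolding power_mult_distrib[of _ T1] T13 .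
    then have "(40000\<^sup>2) ^ 3 * ((real n)\<^sup>2 * L) \<le> real k ^ 3 * \<epsilon> ^ 4"
      using \<epsilon> by (simp add: field_simps)
    then have "real k * ((40000\<^sup>2) ^ 3 * ((real n)\<^sup>2 * L)) \<le> real k * (real k ^ 3 * \<epsilon> ^ 4)"
      by (intro mult_left_mono) auto
    moreover have "(40000 ^ 3 * (s * real n))\<^sup>2 = real k * ((40000\<^sup>2) ^ 3 * ((real n)\<^sup>2 * L))"
      unfolding power_mult_distrib s2 by simp
    moreover have "((real k * \<epsilon>)\<^sup>2)\<^sup>2 = real k * (real k ^ 3 * \<epsilon> ^ 4)"
      by (simp add: power2_eq_square power3_eq_cube power4_eq_xxxx mult_ac)
    ultimately have "(40000 ^ 3 * (s * real n))\<^sup>2 \<le> ((real k * \<epsilon>)\<^sup>2)\<^sup>2" by (simp only:)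
    then have "40000 ^ 3 * (s * real n) \<le> (real k * \<epsilon>)\<^sup>2" by (rule power2_le_imp_le) simp
    moreover have "0 \<le> s * real n" using s0 by simp
    ultimately have "73728 * (s * real n) \<le> (real k * \<epsilon>)\<^sup>2" by simp
    then show ?thesis using D2 zero_le_power2[of "real k * \<epsilon>"] by linarith
  qed
  have b: "73728 * s * sqrt (2 * real k * real n) \<le> D\<^sup>2"
  proof -
    have "40000\<^sup>2 * sqrt (real n * L) \<le> real k * \<epsilon>\<^sup>2"
      using kT(2) \<epsilon> by (simp add: T2_def field_simps)
    then have "real k * (40000\<^sup>2 * sqrt (real n * L)) \<le> real k * (real k * \<epsilon>\<^sup>2)"
      by (intro mult_left_mono) auto
    then have 1: "40000\<^sup>2 * (real k * sqrt (real n * L)) \<le> (real k * \<epsilon>)\<^sup>2"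
      by (simp add: power2_eq_square mult_ac)
    have "s * sqrt (2 * real k * real n) = sqrt 2 * (real k * sqrt (real n * L))"
      by (simp add: s_def real_sqrt_mult mult_ac)
    also have "\<dots> \<le> 2 * (real k * sqrt (real n * L))"
      using sqrt2_less_2 L by (intro mult_right_mono) auto
    finally have "73728 * (s * sqrt (2 * real k * real n)) \<le> 147456 * (real k * sqrt (real n * L))" by simp
    also have "\<dots> \<le> 40000\<^sup>2 * (real k * sqrt (real n * L))" using L by (intro mult_right_mono) auto
    also have "\<dots> \<le> (real k * \<epsilon>)\<^sup>2" by (rule 1)
    also have "\<dots> \<le> D\<^sup>2" using D2 zero_le_power2[of "real k * \<epsilon>"] by linarith
    finally show ?thesis by (simp add: mult.assoc)
  qed
  have c: "73728 * s * D \<le> D\<^sup>2"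
  proof -
    have "40000\<^sup>2 * L \<le> real k * \<epsilon>\<^sup>2" using kT(3) \<epsilon> by (simp add: T3_def field_simps)
    then have "real k * (40000\<^sup>2 * L) \<le> real k * (real k * \<epsilon>\<^sup>2)" by (intro mult_left_mono) auto
    moreover have "(40000 * s)\<^sup>2 = real k * (40000\<^sup>2 * L)"
      unfolding power_mult_distrib s2 by simp
    moreover have "(real k * \<epsilon>)\<^sup>2 = real k * (real k * \<epsilon>\<^sup>2)"
      by (simp add: power2_eq_square mult_ac)
    ultimately have "(40000 * s)\<^sup>2 \<le> (real k * \<epsilon>)\<^sup>2" by (simp only:)
    then have "40000 * s \<le> real k * \<epsilon>" by (rule power2_le_imp_le) (use \<epsilon> in simp)
    \<comment> \<open>Here the size of \<open>40000\<close> matters: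
      \<open>80000 * s <= 2 * k * \<epsilon> <= D\<close>.\<close>
    then have "73728 * s \<le> D" using D s0 by linarith
    then show ?thesis unfolding power2_eq_square by (rule mult_right_mono) (use D0 in simp)
  qed
  have "3 * (24576 * s * (real n + sqrt (2 * real k * real n) + D))
      = 73728 * s * real n + 73728 * s * sqrt (2 * real k * real n) + 73728 * s * D"
    by (simp add: algebra_simps)
  then show ?thesis using a b c unfolding s_def[symmetric] by linarith
qed

theorem theorem3p1:
  shows "\<exists>C C' :: real. C > 0 \<and> C' > 0 \<and>
    (\<forall>(n::nat) (\<epsilon>::real) (\<delta>::real) (k::nat) (p::nat pmf) (q::nat pmf).
       n \<ge> 1 \<longrightarrow> 0 < \<epsilon> \<longrightarrow> \<epsilon> < 1 \<longrightarrow> 0 < \<delta> \<longrightarrow> \<delta> < 1 \<longrightarrow>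
       real k \<ge> C * (real n powr (2/3) * ln (1/\<delta>) powr (1/3) / \<epsilon> powr (4/3)
                    + (real n powr (1/2) * ln (1/\<delta>) powr (1/2) + ln (1/\<delta>)) / \<epsilon>^2) \<longrightarrow>
       set_pmf p \<subseteq> {1..n} \<longrightarrow> set_pmf q \<subseteq> {1..n} \<longrightarrow>
       (p = q \<longrightarrow> pmf (closeness_tester C' n k \<delta> p q) YES \<ge> 1 - \<delta>) \<and>
       (tv_dist n p q \<ge> \<epsilon> \<longrightarrow> pmf (closeness_tester C' n k \<delta> p q) NO \<ge> 1 - \<delta>))"
proof (rule exI[of _ "40000\<^sup>2"], rule exI[of _ 6], intro conjI allI impI)
  fix n k :: nat and \<epsilon> \<delta> :: real and p q :: "nat pmf"
  assume n: "n \<ge> 1" and \<epsilon>: "0 < \<epsilon>" "\<epsilon> < 1" and \<delta>: "0 < \<delta>" "\<delta> < 1"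
    and bound: "real k \<ge> 40000\<^sup>2 * (real n powr (2/3) * ln (1/\<delta>) powr (1/3) / \<epsilon> powr (4/3)
                    + (real n powr (1/2) * ln (1/\<delta>) powr (1/2) + ln (1/\<delta>)) / \<epsilon>^2)"
    and supp: "set_pmf p \<subseteq> {1..n}" "set_pmf q \<subseteq> {1..n}"
  define L where "L = ln (1 / \<delta>)"
  define s where "s = sqrt (real k * L)"
  have L: "0 < L" using \<delta> by (simp add: L_def)
  have k: "k \<ge> 1"
  proof -
    have "0 < 40000\<^sup>2 * (real n powr (2/3) * L powr (1/3) / \<epsilon> powr (4/3)
                    + (real n powr (1/2) * L powr (1/2) + L) / \<epsilon>^2)"
      using L \<epsilon> by (intro mult_pos_pos add_nonneg_pos divide_pos_pos) auto
    with bound have "0 < real k" unfolding L_def by linarith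
    then show ?thesis by simp
  qed
  have fin: "finite (set_pmf p)" "finite (set_pmf q)" using supp by (auto intro: finite_subset)
  let ?R = "replicate_pmf (4 * k) (labelled_sample_pmf p q)"
  let ?Z = "\<lambda>l. real_of_int (labelled_statistic n l)"
  let ?E = "measure_pmf.expectation ?R ?Z"
  have s: "0 \<le> 6 * s" using L by (simp add: s_def)
  \<comment> \<open>With \<open>4 * k\<close> samples and differences at most \<open>4\<close>, the
    exponent is \<open>- 72 * k * L / (64 * k)\<close>. The threshold constant \<open>6\<close> thus
    leaves a factor \<open>9/8\<close> to spare over \<open>L\<close>.\<close>
  have tail: "exp (- 2 * (6 * s)\<^sup>2 / (real (4 * k) * 4\<^sup>2)) \<le> \<delta>"
  proof -
    have "- 2 * (6 * s)\<^sup>2 / (real (4 * k) * 4\<^sup>2) = - (9 / 8) * L"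
      using k L by (simp add: s_def power_mult_distrib field_simps)
    also have "\<dots> \<le> - L" using L by simp
    finally have "exp (- 2 * (6 * s)\<^sup>2 / (real (4 * k) * 4\<^sup>2)) \<le> exp (- L)" by simp
    also have "exp (- L) = \<delta>" using \<delta> by (simp add: L_def ln_div)
    finally show ?thesis .
  qed
  have finR: "finite (set_pmf (labelled_sample_pmf p q))" using fin by simp
  have k4: "0 < 4 * k" using k by simp
  have YES: "pmf (closeness_tester 6 n k \<delta> p q) YES = measure_pmf.prob ?R {l. ?Z l \<le> 6 * s}"
    unfolding closeness_tester_conv_labelled pmf_map s_def L_def
    by (intro arg_cong[where f = "measure_pmf.prob _"]) (auto split: if_splits)
  have NO: "pmf (closeness_tester 6 n k \<delta> p q) NO = measure_pmf.prob ?R {l. \<not> ?Z l \<le> 6 * s}"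
    unfolding closeness_tester_conv_labelled pmf_map s_def L_def
    by (intro arg_cong[where f = "measure_pmf.prob _"]) (auto split: if_splits)
  have compl: "measure_pmf.prob ?R {l. \<not> ?Z l \<le> 6 * s} = 1 - measure_pmf.prob ?R {l. ?Z l \<le> 6 * s}"
    using measure_pmf.prob_compl[of "{l. ?Z l \<le> 6 * s}" ?R]
    by (simp add: Compl_eq_Diff_UNIV[symmetric] Collect_neg_eq)
  {
    assume "p = q"
    \<comment> \<open>For \<open>p = q\<close> all differences of distribution functions
      vanish.\<close>
    then have "?E = 0" unfolding expectation_labelled_statistic[OF fin] by simp
    then have "measure_pmf.prob ?R {l. \<not> ?Z l \<le> 6 * s} \<le> measure_pmf.prob ?R {l. ?Z l \<ge> ?E + 6 * s}"
      by (intro measure_pmf.finite_measure_mono) auto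
    also have "\<dots> \<le> \<delta>"
      using McDiarmid_ge[of "labelled_sample_pmf p q" "4 * k" 4 "6 * s" ?Z,
          OF finR k4 _ s labelled_statistic_bounded_differences] tail by simp
    finally show "1 - \<delta> \<le> pmf (closeness_tester 6 n k \<delta> p q) YES"
      unfolding YES compl by simp
  next
    assume tv: "\<epsilon> \<le> tv_dist n p q"
    define D where "D = 2 * real k * tv_dist n p q"
    define W where "W = 2048 * (real n + sqrt (2 * real k * real n) + D)"
    have D: "2 * real k * \<epsilon> \<le> D" unfolding D_def using tv by (intro mult_left_mono) auto
    have "0 < 2 * real k * \<epsilon>" using k \<epsilon> by simp
    with D have "0 < D" by linarith
    then have W: "0 < W" by (simp add: W_def add_nonneg_pos)
    have "W * (12 * s) = 24576 * s * (real n + sqrt (2 * real k * real n) + D)" by (simp add: W_def)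
    also have "\<dots> \<le> D\<^sup>2" unfolding s_def
      by (rule sample_size_imp_separation[OF \<epsilon>(1) L k bound[folded L_def] D])
    also have "\<dots> \<le> W * ?E" unfolding W_def D_def by (rule expectation_labelled_statistic_ge[OF fin k])
    finally have E: "12 * s \<le> ?E" using W by simp
    \<comment> \<open>As the mean is at least \<open>12 * s\<close>, answering YES requires a
      deviation of at least \<open>6 * s\<close> below it.\<close>
    have "measure_pmf.prob ?R {l. ?Z l \<le> 6 * s} \<le> measure_pmf.prob ?R {l. ?Z l \<le> ?E - 6 * s}"
      using E by (intro measure_pmf.finite_measure_mono) auto
    also have "\<dots> \<le> \<delta>"
      using McDiarmid_le[of "labelled_sample_pmf p q" "4 * k" 4 "6 * s" ?Z,
          OF finR k4 _ s labelled_statistic_bounded_differences] tail by simp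
    finally show "1 - \<delta> \<le> pmf (closeness_tester 6 n k \<delta> p q) NO"
      unfolding NO compl by simp
  }
qed auto

end
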